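(* Let $N,M\ge2$, and let $\pi_1$ be a representation of $\mathcal O_N$ and $\pi_2$ a representation of $\mathcal O_M$. The following holds. (i) If both $\pi_1$ and $\pi_2$ are permutative representations, then $\pi_1\otimes_\varphi\pi_2$ is also a permutative representation (of $\mathcal O_{NM}$). (ii) If both $\pi_1$ and $\pi_2$ are cycles, then $\pi_1\otimes_\varphi\pi_2$ is a direct sum of cycles. (iii) If $\pi_1$ is a permutative representation and $\pi_2$ is a chain, then $\pi_1\otimes_\varphi\pi_2$ is a direct sum of chains.
   Context: For $N\ge2$, $\mathcal O_N$ is the Cuntz algebra: the universal C$^*$-algebra generated by $s_1,\dots,s_N$ (the canonical generators) with $s_i^*s_j=\delta_{ij}I$ and $\sum_{i=1}^N s_is_i^*=I$. All representations are unital $*$-representations on Hilbert spaces. For $N,M\ge2$ let $t_1,\dots,t_N$, $r_1,\dots,r_M$, $s_1,\dots,s_{NM}$ be the canonical generators of $\mathcal O_N,\mathcal O_M,\mathcal O_{NM}$. The unital $*$-embedding $\varphi_{N,M}:\mathcal O_{NM}\to\mathcal O_N\otimes\mathcal O_M$ is defined by $\varphi_{N,M}(s_{M(i-1)+j})=t_i\otimes r_j$ ($i=1,\dots,N$, $j=1,\dots,M$), and $\pi_1\otimes_\varphi\pi_2:=(\pi_1\otimes\pi_2)\circ\varphi_{N,M}$, a representation of $\mathcal O_{NM}$. Permutative representation: a representation $(\mathcal H,\pi)$ of $\mathcal O_N$ is permutative if there are a complete orthonormal basis $\{e_n\}_{n\in\Lambda}$ of $\mathcal H$ and maps $f_1,\dots,f_N$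 on $\Lambda$ such that $\pi(s_i)e_n=e_{f_i(n)}$ for all $n\in\Lambda$, $i=1,\dots,N$. Classes $P_N(J)$: for $J=(j_1,\dots,j_k)\in\{1,\dots,N\}^k$, $k\ge1$, put $s_J=s_{j_1}\cdots s_{j_k}$; $(\mathcal H,\pi)$ is $P_N(J)$ if there is a unit cyclic vector $\Omega\in\mathcal H$ such that $\pi(s_J)\Omega=\Omega$ and $\{\pi(s_{j_l}\cdots s_{j_k})\Omega\}_{l=1}^k$ is an orthonormal family. For $J=(j_n)_{n\in\mathbf N}\in\{1,\dots,N\}^\infty$ (the set of infinite sequences in $\{1,\dots,N\}$), $(\mathcal H,\pi)$ is $P_N(J)$ if there is a unit cyclic vector $\Omega\in\mathcal H$ such that $\{\pi(s_{j_1}\cdots s_{j_n})^*\Omega:n\in\mathbf N\}$ is an orthonormal family (indexed by $n$). A representation of $\mathcal O_N$ is a cycle if it is $P_N(J)$ for some $J\in\{1,\dots,N\}^k$, $k\ge1$, and a chain if it is $P_N(J)$ for some $J\in\{1,\dots,N\}^\infty$. *)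

theory Defs
  imports "HOL-Analysis.Analysis" "HOL-Library.Poly_Mapping"
begin

class complex_vector = real_vector +
  fixes scaleC :: "complex \<Rightarrow> 'a \<Rightarrow> 'a"  (infixr \<open>*\<^sub>C\<close> 75)
  assumes scaleC_add_right: "a *\<^sub>C (x + y) = a *\<^sub>C x + a *\<^sub>C y"
    and scaleC_add_left: "(a + b) *\<^sub>C x = a *\<^sub>C x + b *\<^sub>C x"
    and scaleC_scaleC: "a *\<^sub>C (b *\<^sub>C x) = (a * b) *\<^sub>C x"
    and scaleC_one: "1 *\<^sub>C x = x"
    and scaleR_scaleC: "r *\<^sub>R x = complex_of_real r *\<^sub>C x"

global_interpretation complex_vector:
  vector_space "scaleC :: complex \<Rightarrow> 'a \<Rightarrow> 'a::complex_vector"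
  defines cspan = complex_vector.span
    and csubspace = complex_vector.subspace
    and cdependent = complex_vector.dependent
  by unfold_locales (simp_all add: scaleC_add_right scaleC_add_left scaleC_scaleC scaleC_one)

text \<open>The complex inner product is conjugate linear in its first argument; its real part is
  the inner product of the underlying real space, which determines norm and topology.\<close>

class complex_hilbert_space = complex_vector + real_inner + complete_space +
  fixes cinner :: "'a \<Rightarrow> 'a \<Rightarrow> complex"
  assumes cinner_commute: "cinner x y = cnj (cinner y x)"
    and cinner_add_left: "cinner (x + y) z = cinner x z + cinner y z"
    and cinner_scaleC_left: "cinner (c *\<^sub>C x) y = cnj c * cinner x y"
    and inner_eq_Re_cinner: "inner x y = Re (cinner x y)"

class cstar_algebra = complex_vector + real_normed_algebra_1 + complete_space +
  fixes cstar :: "'a \<Rightarrow> 'a"  (\<open>_\<^sup>\<star>\<close> [1000] 999)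
  assumes mult_scaleC_left: "(c *\<^sub>C x) * y = c *\<^sub>C (x * y)"
    and mult_scaleC_right: "x * (c *\<^sub>C y) = c *\<^sub>C (x * y)"
    and norm_scaleC: "norm (c *\<^sub>C x) = cmod c * norm x"
    and cstar_add: "(x + y)\<^sup>\<star> = x\<^sup>\<star> + y\<^sup>\<star>"
    and cstar_scaleC: "(c *\<^sub>C x)\<^sup>\<star> = cnj c *\<^sub>C x\<^sup>\<star>"
    and cstar_mult: "(x * y)\<^sup>\<star> = y\<^sup>\<star> * x\<^sup>\<star>"
    and cstar_cstar: "(x\<^sup>\<star>)\<^sup>\<star> = x"
    and norm_cstar_mult: "norm (x\<^sup>\<star> * x) = (norm x)\<^sup>2"

definition unital_star_hom :: "('a::cstar_algebra \<Rightarrow> 'b::cstar_algebra) \<Rightarrow> bool" where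
  "unital_star_hom h \<longleftrightarrow>
     (\<forall>x y. h (x + y) = h x + h y) \<and>
     (\<forall>c x. h (c *\<^sub>C x) = c *\<^sub>C h x) \<and>
     (\<forall>x y. h (x * y) = h x * h y) \<and>
     (\<forall>x. h (x\<^sup>\<star>) = (h x)\<^sup>\<star>) \<and>
     h 1 = 1"

datatype letter = Gen nat | GenStar nat

fun letter_index :: "letter \<Rightarrow> nat" where
  "letter_index (Gen i) = i"
| "letter_index (GenStar i) = i"

fun letter_star :: "letter \<Rightarrow> letter" where
  "letter_star (Gen i) = GenStar i"
| "letter_star (GenStar i) = Gen i"

datatype star_word = Word (letters: "letter list")

instantiation star_word :: monoid_add
begin

definition zero_star_word :: star_word where
  "0 = Word []"

definition plus_star_word :: "star_word \<Rightarrow> star_word \<Rightarrow> star_word" where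
  "v + w = Word (letters v @ letters w)"

instance
  by standard (auto simp: zero_star_word_def plus_star_word_def)

end

text \<open>The ring structure on \<open>star_word \<Rightarrow>\<^sub>0 complex\<close> is the convolution product over the
  concatenation monoid of words.\<close>

type_synonym free_star = "star_word \<Rightarrow>\<^sub>0 complex"

definition free_star_algebra :: "nat \<Rightarrow> free_star set" where
  "free_star_algebra N =
     {p. \<forall>w\<in>Poly_Mapping.keys p. \<forall>l\<in>set (letters w). letter_index l \<in> {1..N}}"

definition free_const :: "complex \<Rightarrow> free_star" where
  "free_const c = Poly_Mapping.single 0 c"

definition free_gen :: "nat \<Rightarrow> free_star" where
  "free_gen i = Poly_Mapping.single (Word [Gen i]) 1"

definition word_star :: "star_word \<Rightarrow> star_word" where
  "word_star w = Word (rev (map letter_star (letters w)))"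

definition free_cstar :: "free_star \<Rightarrow> free_star" where
  "free_cstar p =
     (\<Sum>w\<in>Poly_Mapping.keys p. Poly_Mapping.single (word_star w) (cnj (Poly_Mapping.lookup p w)))"

fun letter_eval :: "(nat \<Rightarrow> 'a::cstar_algebra) \<Rightarrow> letter \<Rightarrow> 'a" where
  "letter_eval s (Gen i) = s i"
| "letter_eval s (GenStar i) = (s i)\<^sup>\<star>"

definition free_eval :: "(nat \<Rightarrow> 'a::cstar_algebra) \<Rightarrow> free_star \<Rightarrow> 'a" where
  "free_eval s p =
     (\<Sum>w\<in>Poly_Mapping.keys p.
        Poly_Mapping.lookup p w *\<^sub>C prod_list (map (letter_eval s) (letters w)))"

definition cuntz_relations :: "nat \<Rightarrow> (nat \<Rightarrow> 'a::cstar_algebra) \<Rightarrow> bool" where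
  "cuntz_relations N s \<longleftrightarrow>
     (\<forall>i\<in>{1..N}. \<forall>j\<in>{1..N}. (s i)\<^sup>\<star> * s j = (if i = j then 1 else 0)) \<and>
     (\<Sum>i=1..N. s i * (s i)\<^sup>\<star>) = 1"

definition cuntz_seminorm :: "nat \<Rightarrow> (free_star \<Rightarrow> real) \<Rightarrow> bool" where
  "cuntz_seminorm N q \<longleftrightarrow>
     (\<forall>x\<in>free_star_algebra N. \<forall>y\<in>free_star_algebra N.
        q (x + y) \<le> q x + q y \<and> q (x * y) \<le> q x * q y) \<and>
     (\<forall>c. \<forall>x\<in>free_star_algebra N. q (free_const c * x) = cmod c * q x) \<and>
     (\<forall>x\<in>free_star_algebra N. q (free_cstar x * x) = (q x)\<^sup>2) \<and>
     (\<forall>i\<in>{1..N}. \<forall>j\<in>{1..N}.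
        q (free_cstar (free_gen i) * free_gen j - (if i = j then 1 else 0)) = 0) \<and>
     q ((\<Sum>i=1..N. free_gen i * free_cstar (free_gen i)) - 1) = 0"

text \<open>The C*-algebra \<open>'a\<close>, with canonical generators \<open>s 1, \<dots>, s N\<close>, is the universal
  C*-algebra for the Cuntz relations, i.e. the completion of the free *-algebra with respect to
  the largest C*-seminorm for which the relations hold. Maximality of the seminorm expresses the
  universal property without quantifying over all C*-algebras, which a single type cannot do.\<close>

definition cuntz_algebra :: "nat \<Rightarrow> (nat \<Rightarrow> 'a::cstar_algebra) \<Rightarrow> bool" where
  "cuntz_algebra N s \<longleftrightarrow>
     cuntz_relations N s \<and>
     closure (free_eval s ` free_star_algebra N) = UNIV \<and>
     (\<forall>q. cuntz_seminorm N q \<longrightarrow> (\<forall>x\<in>free_star_algebra N. q x \<le> norm (free_eval s x)))"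

definition cbilinear ::
  "('a::complex_vector \<Rightarrow> 'b::complex_vector \<Rightarrow> 'c::complex_vector) \<Rightarrow> bool" where
  "cbilinear B \<longleftrightarrow>
     (\<forall>x x' y. B (x + x') y = B x y + B x' y) \<and>
     (\<forall>x y y'. B x (y + y') = B x y + B x y') \<and>
     (\<forall>c x y. B (c *\<^sub>C x) y = c *\<^sub>C B x y) \<and>
     (\<forall>c x y. B x (c *\<^sub>C y) = c *\<^sub>C B x y)"

text \<open>\<open>'c\<close> is the Hilbert space tensor product of \<open>'a\<close> and \<open>'b\<close>, with elementary tensors
  \<open>T x y\<close>; this determines \<open>('c, T)\<close> up to a unique unitary.\<close>

definition hilbert_tensor ::
  "('a::complex_hilbert_space \<Rightarrow> 'b::complex_hilbert_space \<Rightarrow> 'c::complex_hilbert_space) \<Rightarrow> bool" where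
  "hilbert_tensor T \<longleftrightarrow>
     cbilinear T \<and>
     (\<forall>x y x' y'. cinner (T x y) (T x' y') = cinner x x' * cinner y y') \<and>
     closure (cspan {T x y | x y. True}) = UNIV"

text \<open>\<open>'c\<close> is a C*-tensor product of \<open>'a\<close> and \<open>'b\<close>: a C*-completion of their algebraic tensor
  product. The condition on \<open>cdependent\<close> says that the canonical map from the algebraic tensor
  product is injective. Cuntz algebras are nuclear, so for them the C*-norm on the algebraic
  tensor product, and hence \<open>('c, T)\<close>, is unique.\<close>

definition cstar_tensor ::
  "('a::cstar_algebra \<Rightarrow> 'b::cstar_algebra \<Rightarrow> 'c::cstar_algebra) \<Rightarrow> bool" where
  "cstar_tensor T \<longleftrightarrow>
     cbilinear T \<and>
     (\<forall>a b a' b'. T a b * T a' b' = T (a * a') (b * b')) \<and>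
     (\<forall>a b. (T a b)\<^sup>\<star> = T (a\<^sup>\<star>) (b\<^sup>\<star>)) \<and>
     T 1 1 = 1 \<and>
     (\<forall>B f. finite B \<and> \<not> cdependent B \<and> (\<Sum>b\<in>B. T (f b) b) = 0 \<longrightarrow> (\<forall>b\<in>B. f b = 0)) \<and>
     closure (cspan {T a b | a b. True}) = UNIV"

text \<open>\<open>\<phi>\<close> is the embedding \<open>\<phi>\<^bsub>N,M\<^esub>\<close>; it is determined by its values on the generators.\<close>

definition cuntz_embedding ::
  "nat \<Rightarrow> nat \<Rightarrow> (nat \<Rightarrow> 'a::cstar_algebra) \<Rightarrow> (nat \<Rightarrow> 'b::cstar_algebra) \<Rightarrow>
   (nat \<Rightarrow> 'c::cstar_algebra) \<Rightarrow> ('a \<Rightarrow> 'b \<Rightarrow> 'd::cstar_algebra) \<Rightarrow> ('c \<Rightarrow> 'd) \<Rightarrow> bool" where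
  "cuntz_embedding N M t r s T \<phi> \<longleftrightarrow>
     unital_star_hom \<phi> \<and>
     (\<forall>i\<in>{1..N}. \<forall>j\<in>{1..M}. \<phi> (s (M * (i - 1) + j)) = T (t i) (r j))"

text \<open>A representation \<open>(V, \<pi>)\<close> lives on a closed subspace \<open>V\<close> of the ambient Hilbert space, so
  that subrepresentations are covered; only the values of \<open>\<pi> a\<close> on \<open>V\<close> matter. The last
  condition says that \<open>\<pi> (a\<^sup>\<star>)\<close> is the adjoint of \<open>\<pi> a\<close>.\<close>

definition star_rep ::
  "'h::complex_hilbert_space set \<Rightarrow> ('a::cstar_algebra \<Rightarrow> 'h \<Rightarrow> 'h) \<Rightarrow> bool" where
  "star_rep V \<pi> \<longleftrightarrow>
     closed V \<and> csubspace V \<and>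
     (\<forall>a. \<forall>x\<in>V. \<pi> a x \<in> V) \<and>
     (\<forall>a. \<forall>x\<in>V. \<forall>y\<in>V. \<pi> a (x + y) = \<pi> a x + \<pi> a y) \<and>
     (\<forall>a c. \<forall>x\<in>V. \<pi> a (c *\<^sub>C x) = c *\<^sub>C \<pi> a x) \<and>
     (\<forall>a. \<exists>K. \<forall>x\<in>V. norm (\<pi> a x) \<le> K * norm x) \<and>
     (\<forall>a b. \<forall>x\<in>V. \<pi> (a + b) x = \<pi> a x + \<pi> b x) \<and>
     (\<forall>c a. \<forall>x\<in>V. \<pi> (c *\<^sub>C a) x = c *\<^sub>C \<pi> a x) \<and>
     (\<forall>a b. \<forall>x\<in>V. \<pi> (a * b) x = \<pi> a (\<pi> b x)) \<and>
     (\<forall>x\<in>V. \<pi> 1 x = x) \<and>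
     (\<forall>a. \<forall>x\<in>V. \<forall>y\<in>V. cinner (\<pi> a x) y = cinner x (\<pi> (a\<^sup>\<star>) y))"

text \<open>\<open>\<rho>\<close> is the representation \<open>\<pi>\<^sub>1 \<otimes> \<pi>\<^sub>2\<close> of the C*-tensor product on the Hilbert space tensor
  product; it is determined by its values on elementary tensors.\<close>

definition tensor_rep ::
  "('a::cstar_algebra \<Rightarrow> 'b::cstar_algebra \<Rightarrow> 'd::cstar_algebra) \<Rightarrow>
   ('h::complex_hilbert_space \<Rightarrow> 'k::complex_hilbert_space \<Rightarrow> 'l::complex_hilbert_space) \<Rightarrow>
   ('a \<Rightarrow> 'h \<Rightarrow> 'h) \<Rightarrow> ('b \<Rightarrow> 'k \<Rightarrow> 'k) \<Rightarrow> ('d \<Rightarrow> 'l \<Rightarrow> 'l) \<Rightarrow> bool" where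
  "tensor_rep T S \<pi>\<^sub>1 \<pi>\<^sub>2 \<rho> \<longleftrightarrow>
     star_rep UNIV \<rho> \<and> (\<forall>a b x y. \<rho> (T a b) (S x y) = S (\<pi>\<^sub>1 a x) (\<pi>\<^sub>2 b y))"

definition orthonormal_family :: "'i set \<Rightarrow> ('i \<Rightarrow> 'h::complex_hilbert_space) \<Rightarrow> bool" where
  "orthonormal_family I e \<longleftrightarrow>
     (\<forall>m\<in>I. \<forall>n\<in>I. cinner (e m) (e n) = (if m = n then 1 else 0))"

definition cyclic_vector ::
  "'h::complex_hilbert_space set \<Rightarrow> ('a::cstar_algebra \<Rightarrow> 'h \<Rightarrow> 'h) \<Rightarrow> 'h \<Rightarrow> bool" where
  "cyclic_vector V \<pi> \<Omega> \<longleftrightarrow> \<Omega> \<in> V \<and> closure (range (\<lambda>a. \<pi> a \<Omega>)) = V"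

text \<open>An orthonormal family is injective, so an index set \<open>\<Lambda>\<close> inside the type \<open>'h\<close> is no
  restriction.\<close>

definition permutative ::
  "nat \<Rightarrow> (nat \<Rightarrow> 'a::cstar_algebra) \<Rightarrow> 'h::complex_hilbert_space set \<Rightarrow> ('a \<Rightarrow> 'h \<Rightarrow> 'h) \<Rightarrow> bool" where
  "permutative N s V \<pi> \<longleftrightarrow>
     star_rep V \<pi> \<and>
     (\<exists>(\<Lambda>::'h set) (e::'h \<Rightarrow> 'h) (f::nat \<Rightarrow> 'h \<Rightarrow> 'h).
        orthonormal_family \<Lambda> e \<and> closure (cspan (e ` \<Lambda>)) = V \<and>
        (\<forall>i\<in>{1..N}. \<forall>n\<in>\<Lambda>. f i n \<in> \<Lambda> \<and> \<pi> (s i) (e n) = e (f i n)))"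

definition gen_word :: "(nat \<Rightarrow> 'a::monoid_mult) \<Rightarrow> nat list \<Rightarrow> 'a" where
  "gen_word s J = prod_list (map s J)"

definition P_finite ::
  "nat \<Rightarrow> (nat \<Rightarrow> 'a::cstar_algebra) \<Rightarrow> nat list \<Rightarrow>
   'h::complex_hilbert_space set \<Rightarrow> ('a \<Rightarrow> 'h \<Rightarrow> 'h) \<Rightarrow> bool" where
  "P_finite N s J V \<pi> \<longleftrightarrow>
     J \<noteq> [] \<and> set J \<subseteq> {1..N} \<and>
     star_rep V \<pi> \<and>
     (\<exists>\<Omega>. norm \<Omega> = 1 \<and> cyclic_vector V \<pi> \<Omega> \<and> \<pi> (gen_word s J) \<Omega> = \<Omega> \<and>
        orthonormal_family {..<length J} (\<lambda>l. \<pi> (gen_word s (drop l J)) \<Omega>))"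

text \<open>An infinite sequence \<open>(j\<^sub>n)\<close> is indexed from \<open>n = 1\<close>; the value \<open>J 0\<close> is irrelevant. We use
  \<open>\<pi> (a)\<^sup>\<star> = \<pi> (a\<^sup>\<star>)\<close>.\<close>

definition P_infinite ::
  "nat \<Rightarrow> (nat \<Rightarrow> 'a::cstar_algebra) \<Rightarrow> (nat \<Rightarrow> nat) \<Rightarrow>
   'h::complex_hilbert_space set \<Rightarrow> ('a \<Rightarrow> 'h \<Rightarrow> 'h) \<Rightarrow> bool" where
  "P_infinite N s J V \<pi> \<longleftrightarrow>
     (\<forall>n\<ge>1. J n \<in> {1..N}) \<and>
     star_rep V \<pi> \<and>
     (\<exists>\<Omega>. norm \<Omega> = 1 \<and> cyclic_vector V \<pi> \<Omega> \<and>
        orthonormal_family {1..} (\<lambda>n. \<pi> ((gen_word s (map J [1..<Suc n]))\<^sup>\<star>) \<Omega>))"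

definition is_cycle ::
  "nat \<Rightarrow> (nat \<Rightarrow> 'a::cstar_algebra) \<Rightarrow> 'h::complex_hilbert_space set \<Rightarrow> ('a \<Rightarrow> 'h \<Rightarrow> 'h) \<Rightarrow> bool" where
  "is_cycle N s V \<pi> \<longleftrightarrow> (\<exists>J. P_finite N s J V \<pi>)"

definition is_chain ::
  "nat \<Rightarrow> (nat \<Rightarrow> 'a::cstar_algebra) \<Rightarrow> 'h::complex_hilbert_space set \<Rightarrow> ('a \<Rightarrow> 'h \<Rightarrow> 'h) \<Rightarrow> bool" where
  "is_chain N s V \<pi> \<longleftrightarrow> (\<exists>J. P_infinite N s J V \<pi>)"

text \<open>\<open>(V, \<pi>)\<close> is the Hilbert space direct sum of subrepresentations \<open>(W, \<pi>)\<close> satisfying \<open>P\<close>.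
  Cycles and chains are nonzero, so orthogonal summands are distinct and indexing the summands
  by their underlying subspaces loses nothing.\<close>

definition direct_sum_of ::
  "('h::complex_hilbert_space set \<Rightarrow> ('a::cstar_algebra \<Rightarrow> 'h \<Rightarrow> 'h) \<Rightarrow> bool) \<Rightarrow>
   'h set \<Rightarrow> ('a \<Rightarrow> 'h \<Rightarrow> 'h) \<Rightarrow> bool" where
  "direct_sum_of P V \<pi> \<longleftrightarrow>
     star_rep V \<pi> \<and>
     (\<exists>\<W>. (\<forall>W\<in>\<W>. star_rep W \<pi> \<and> P W \<pi>) \<and>
        (\<forall>W\<in>\<W>. \<forall>W'\<in>\<W>. W \<noteq> W' \<longrightarrow> (\<forall>x\<in>W. \<forall>y\<in>W'. cinner x y = 0)) \<and>
        closure (cspan (\<Union>\<W>)) = V)"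

end

theory Submission
  imports Defs
begin

text \<open>A permutative basis \<open>B\<close> carries a shift \<open>F\<close> with \<open>F (s\<^sub>i b) = b\<close>: by the relation
  \<open>\<Sum>\<^sub>i s\<^sub>i s\<^sub>i\<^sup>\<star> = 1\<close> and totality, every basis vector is \<open>s\<^sub>i b\<close> for exactly one \<open>i\<close> and one
  \<open>b \<in> B\<close>. Calling \<open>x, y \<in> B\<close> tail equivalent if \<open>F\<^sup>m x = F\<^sup>n y\<close> for some \<open>m, n\<close>, the closed span
  of each tail class is a subrepresentation for which every vector of the class is cyclic. It is a
  cycle if the class contains an \<open>F\<close>-periodic vector, and a chain if some \<open>F\<close>-orbit in the class is
  injective.

  A cycle or chain has a permutative basis, namely all \<open>s\<^sub>K \<Omega>\<^sub>n\<close> with \<open>\<Omega>\<^sub>n\<close> the vectors of the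
  defining orthonormal family; all \<open>F\<close>-orbits are eventually periodic for a cycle and injective for
  a chain. The elementary tensors of two permutative bases form a permutative basis of the tensor
  product, on which the shift is \<open>F\<^sub>1 \<otimes> F\<^sub>2\<close>: it is eventually periodic if both factors are, and has
  injective orbits as soon as one factor does.\<close>

section \<open>Complex Hilbert spaces\<close>

lemma cinner_add_right: "cinner x (y + z) = cinner x y + cinner x z"
  by (metis cinner_add_left cinner_commute complex_cnj_add)

lemma cinner_scaleC_right: "cinner x (c *\<^sub>C y) = c * cinner x y"
  by (metis cinner_commute cinner_scaleC_left complex_cnj_cnj complex_cnj_mult)

lemma cinner_zero_right [simp]: "cinner x 0 = 0"
  using cinner_add_right[of x 0 0] by simp

lemma cinner_eq_zero_commute: "cinner x y = 0 \<longleftrightarrow> cinner y x = 0"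
  using cinner_commute[of x y] by simp

lemma cinner_self: "cinner x x = complex_of_real ((norm x)\<^sup>2)"
proof -
  have "cinner x x \<in> \<real>"
    using cinner_commute[of x x] by (simp add: Reals_cnj_iff)
  then show ?thesis
    by (metis inner_eq_Re_cinner of_real_Re power2_norm_eq_inner)
qed

text \<open>Both sides are squared and compared through \<open>cinner\<close>, because the class
  ties the norm to real scalars only.\<close>

lemma norm_scaleC_hilbert: "norm (c *\<^sub>C x) = cmod c * norm (x::'a::complex_hilbert_space)"
proof -
  have "complex_of_real ((norm (c *\<^sub>C x))\<^sup>2) = complex_of_real ((cmod c * norm x)\<^sup>2)"
    unfolding cinner_self[symmetric] cinner_scaleC_left cinner_scaleC_right
    by (simp add: cinner_self power_mult_distrib complex_norm_square[symmetric]
        mult.assoc[symmetric] mult.commute[of "cnj c"])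
  then have "(norm (c *\<^sub>C x))\<^sup>2 = (cmod c * norm x)\<^sup>2"
    unfolding of_real_eq_iff .
  then show ?thesis
    by (simp add: power2_eq_iff_nonneg)
qed

text \<open>The factor \<open>\<i>\<close> leaves the conjugate linear argument as
  \<open>-\<i>\<close> and so turns the imaginary part into a real part. Continuity of
  \<open>cinner\<close> thereby reduces to that of the real inner product.\<close>

lemma Im_cinner: "Im (cinner x y) = inner (\<i> *\<^sub>C x) y"
  by (simp add: inner_eq_Re_cinner cinner_scaleC_left)

lemma tendsto_cinner_right:
  assumes "(f \<longlongrightarrow> y) F"
  shows "((\<lambda>n. cinner x (f n)) \<longlongrightarrow> cinner x y) F"
  by (subst tendsto_complex_iff)
     (auto simp: Im_cinner inner_eq_Re_cinner[symmetric] intro!: tendsto_intros assms)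

lemma continuous_on_cinner_right: "continuous_on A (cinner x)"
  unfolding continuous_on_def by (auto intro: tendsto_cinner_right)

section \<open>Closed complex spans and orthogonality\<close>

lemma csubspace_closure:
  fixes V :: "'a::complex_hilbert_space set"
  assumes "csubspace V"
  shows "csubspace (closure V)"
  unfolding complex_vector.subspace_def
proof (intro conjI ballI allI)
  show "0 \<in> closure V"
    using assms closure_subset complex_vector.subspace_0 by blast
next
  fix x y assume "x \<in> closure V" "y \<in> closure V"
  then obtain f g where fg: "\<And>n. f n \<in> V" "\<And>n. g n \<in> V" "f \<longlonglongrightarrow> x" "g \<longlonglongrightarrow> y"
    unfolding closure_sequential by metis
  then have "(\<lambda>n. f n + g n) \<longlonglongrightarrow> x + y"
    by (intro tendsto_intros)
  moreover have "\<forall>n. f n + g n \<in> V"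
    using fg assms by (simp add: complex_vector.subspace_add)
  ultimately show "x + y \<in> closure V"
    unfolding closure_sequential by (intro exI conjI)
next
  fix c :: complex and x assume "x \<in> closure V"
  then obtain f where f: "\<And>n. f n \<in> V" "f \<longlonglongrightarrow> x"
    unfolding closure_sequential by metis
  have "(\<lambda>n. cmod c * norm (f n - x)) \<longlonglongrightarrow> 0"
    using tendsto_mult_right_zero tendsto_norm_zero[OF LIM_zero[OF f(2)]] by blast
  then have "(\<lambda>n. c *\<^sub>C f n) \<longlonglongrightarrow> c *\<^sub>C x"
    by (subst tendsto_dist_iff)
       (simp add: dist_norm norm_scaleC_hilbert complex_vector.scale_right_diff_distrib[symmetric])
  moreover have "\<forall>n. c *\<^sub>C f n \<in> V"
    using f assms by (simp add: complex_vector.subspace_scale)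
  ultimately show "c *\<^sub>C x \<in> closure V"
    unfolding closure_sequential by (intro exI conjI)
qed

lemma csubspace_closure_cspan: "csubspace (closure (cspan B))"
  for B :: "'a::complex_hilbert_space set"
  by (simp add: csubspace_closure complex_vector.subspace_span)

lemma subset_closure_cspan: "B \<subseteq> closure (cspan B)"
  for B :: "'a::complex_hilbert_space set"
  using closure_subset complex_vector.span_superset by blast

lemma closure_cspan_subset:
  fixes B :: "'a::complex_hilbert_space set"
  assumes "B \<subseteq> V" "csubspace V" "closed V"
  shows "closure (cspan B) \<subseteq> V"
  by (intro closure_minimal complex_vector.span_minimal assms)

lemma cinner_closure_cspan_right:
  assumes "\<And>y. y \<in> B \<Longrightarrow> cinner x y = 0" and "y \<in> closure (cspan B)"
  shows "cinner x y = 0"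
proof -
  have "closed {y. cinner x y = 0}"
    by (intro closed_Collect_eq continuous_on_cinner_right continuous_on_const)
  moreover have "csubspace {y. cinner x y = 0}"
    by (auto simp: complex_vector.subspace_def cinner_add_right cinner_scaleC_right)
  ultimately have "closure (cspan B) \<subseteq> {y. cinner x y = 0}"
    using assms(1) by (intro closure_cspan_subset) auto
  with assms(2) show ?thesis by blast
qed

lemma cinner_closure_cspan:
  assumes "\<And>x y. x \<in> A \<Longrightarrow> y \<in> B \<Longrightarrow> cinner x y = 0"
    and "x \<in> closure (cspan A)" and "y \<in> closure (cspan B)"
  shows "cinner x y = 0"
proof (rule cinner_closure_cspan_right[OF _ assms(3)])
  fix y assume "y \<in> B"
  then have "cinner y x = 0"
    using assms(1) cinner_eq_zero_commute
    by (intro cinner_closure_cspan_right[OF _ assms(2)]) blast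
  then show "cinner x y = 0"
    using cinner_eq_zero_commute by blast
qed

lemma orthogonal_total_eq_zero:
  assumes "closure (cspan B) = UNIV" and "\<And>y. y \<in> B \<Longrightarrow> cinner x y = 0"
  shows "x = 0"
proof -
  have "x \<in> closure (cspan B)"
    unfolding assms(1) by (rule UNIV_I)
  with assms(2) have "cinner x x = 0"
    by (rule cinner_closure_cspan_right)
  then show ?thesis
    by (simp add: cinner_self)
qed

text \<open>Additivity turns a difference of values into the value at the difference, where the
  bound applies. It serves for \<open>\<pi>\<close> in either argument and for either slot of a
  tensor.\<close>

lemma continuous_additive_bounded:
  fixes f :: "'a::real_normed_vector \<Rightarrow> 'b::real_normed_vector"
  assumes add: "\<And>x y. f (x + y) = f x + f y" and bound: "\<And>x. norm (f x) \<le> K * norm x"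
  shows "continuous_on UNIV f"
  unfolding continuous_on_def
proof (intro ballI)
  fix x
  have diff: "f y - f x = f (y - x)" for y
    using add[of "y - x" x] by simp
  have "((\<lambda>y. K * norm (y - x)) \<longlongrightarrow> K * norm (x - x)) (at x within UNIV)"
    by (intro tendsto_intros)
  then have lim: "((\<lambda>y. K * norm (y - x)) \<longlongrightarrow> 0) (at x within UNIV)"
    by simp
  have "((\<lambda>y. f y - f x) \<longlongrightarrow> 0) (at x within UNIV)"
    by (rule Lim_null_comparison[OF _ lim]) (simp add: diff bound)
  then show "(f \<longlongrightarrow> f x) (at x within UNIV)"
    by (rule LIM_zero_cancel)
qed

section \<open>Contractivity of representations\<close>

text \<open>The C*-identity and submultiplicativity give
  \<open>norm y * norm y \<le> norm (y\<^sup>\<star>) * norm y\<close>; cancelling, for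
  \<open>x\<close> and for its adjoint, gives both inequalities.\<close>

lemma norm_cstar: "norm (x\<^sup>\<star>) = norm (x::'a::cstar_algebra)"
proof -
  have le: "norm y \<le> norm (y\<^sup>\<star>)" for y :: 'a
  proof (cases "y = 0")
    case False
    have "norm y * norm y \<le> norm (y\<^sup>\<star>) * norm y"
      using norm_cstar_mult[of y] norm_mult_ineq[of "y\<^sup>\<star>" y] by (simp add: power2_eq_square)
    with False show ?thesis by simp
  qed simp
  from le[of x] le[of "x\<^sup>\<star>"] show ?thesis
    by (simp add: cstar_cstar)
qed

lemma cstar_one [simp]: "(1::'a::cstar_algebra)\<^sup>\<star> = 1"
  by (metis cstar_cstar cstar_mult mult.right_neutral)

lemma cstar_diff: "(x - y)\<^sup>\<star> = x\<^sup>\<star> - (y\<^sup>\<star> :: 'a::cstar_algebra)"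
  using cstar_add[of "x - y" y] by (simp add: algebra_simps)

lemma cstar_scaleR: "(c *\<^sub>R x)\<^sup>\<star> = c *\<^sub>R (x\<^sup>\<star> :: 'a::cstar_algebra)"
  by (simp add: scaleR_scaleC cstar_scaleC)

text \<open>This replaces the spectral calculus in the proof that representations are automatically
  continuous. The square root is \<open>1 - y\<close>, where \<open>y\<close> is the fixed point of the contraction
  \<open>y \<mapsto> (h + y\<^sup>2) / 2\<close> on the ball of radius \<open>norm h\<close>; uniqueness makes \<open>y\<close> self-adjoint.\<close>

lemma selfadjoint_sqrt_one_minus:
  fixes h :: "'a::cstar_algebra"
  assumes "h\<^sup>\<star> = h" and "norm h < 1"
  obtains c where "c\<^sup>\<star> = c" and "c * c = 1 - h"
proof -
  let ?f = "\<lambda>y. (1/2) *\<^sub>R (h + y * y)"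
  let ?D = "cball 0 (norm h) :: 'a set"
  have maps: "?f ` ?D \<subseteq> ?D"
  proof clarify
    fix y assume "y \<in> ?D"
    then have y: "norm y \<le> norm h" by simp
    have "norm (y * y) \<le> norm h * 1"
      using norm_mult_ineq[of y y] mult_mono[OF y, of "norm y" 1] y assms(2) by simp
    then show "?f y \<in> ?D"
      using norm_triangle_ineq[of h "y * y"] by simp
  qed
  have contr: "dist (?f x) (?f y) \<le> norm h * dist x y" if "x \<in> ?D" "y \<in> ?D" for x y
  proof -
    \<comment> \<open>This factorisation does not commute \<open>x\<close> and \<open>y\<close>.
      Both have norm at most \<open>norm h\<close>, and the resulting factor 2 cancels the 1/2 in
      the map.\<close>
    have "norm (x * x - y * y) = norm (x * (x - y) + (x - y) * y)"
      by (simp add: algebra_simps)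
    also have "\<dots> \<le> norm x * norm (x - y) + norm (x - y) * norm y"
      by (meson add_mono norm_mult_ineq norm_triangle_le)
    also have "\<dots> \<le> norm h * norm (x - y) + norm (x - y) * norm h"
      using that by (intro add_mono mult_left_mono mult_right_mono) auto
    finally have "norm (x * x - y * y) \<le> 2 * (norm h * norm (x - y))"
      by simp
    moreover have "?f x - ?f y = (1/2) *\<^sub>R (x * x - y * y)"
      by (simp add: algebra_simps)
    ultimately show ?thesis
      by (simp add: dist_norm)
  qed
  have ex1: "\<exists>!y\<in>?D. ?f y = y"
  proof (rule Banach_fix[where c = "norm h"])
    show "complete ?D" by (simp add: complete_eq_closed)
    show "?D \<noteq> {}" by auto
    show "0 \<le> norm h" by simp
  qed (use assms(2) maps contr in auto)
  then obtain y where y: "y \<in> ?D" "?f y = y" by blast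
  have "?f (y\<^sup>\<star>) = (?f y)\<^sup>\<star>"
    by (simp add: cstar_scaleR cstar_add cstar_mult assms(1))
  then have "y\<^sup>\<star> = y"
    using ex1 y by (metis dist_0_norm mem_cball norm_cstar)
  moreover have "h + y * y = y + y"
    using arg_cong[OF y(2), of "scaleR 2"] by (simp add: scaleR_2)
  ultimately show ?thesis
    by (intro that[of "1 - y"]) (auto simp: cstar_diff algebra_simps)
qed

section \<open>Boundedness and continuity of representations\<close>

lemma star_repD:
  assumes "star_rep V \<pi>"
  shows "closed V" "csubspace V"
    and "\<And>a x. x \<in> V \<Longrightarrow> \<pi> a x \<in> V"
    and "\<And>a x y. x \<in> V \<Longrightarrow> y \<in> V \<Longrightarrow> \<pi> a (x + y) = \<pi> a x + \<pi> a y"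
    and "\<And>a c x. x \<in> V \<Longrightarrow> \<pi> a (c *\<^sub>C x) = c *\<^sub>C \<pi> a x"
    and "\<And>a. \<exists>K. \<forall>x\<in>V. norm (\<pi> a x) \<le> K * norm x"
    and "\<And>a b x. x \<in> V \<Longrightarrow> \<pi> (a + b) x = \<pi> a x + \<pi> b x"
    and "\<And>c a x. x \<in> V \<Longrightarrow> \<pi> (c *\<^sub>C a) x = c *\<^sub>C \<pi> a x"
    and "\<And>a b x. x \<in> V \<Longrightarrow> \<pi> (a * b) x = \<pi> a (\<pi> b x)"
    and "\<And>x. x \<in> V \<Longrightarrow> \<pi> 1 x = x"
    and "\<And>a x y. x \<in> V \<Longrightarrow> y \<in> V \<Longrightarrow> cinner (\<pi> a x) y = cinner x (\<pi> (a\<^sup>\<star>) y)"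
  using assms by (simp_all add: star_rep_def)

lemma star_rep_subrep:
  assumes "star_rep UNIV \<pi>" "closed W" "csubspace W" "\<And>a x. x \<in> W \<Longrightarrow> \<pi> a x \<in> W"
  shows "star_rep W \<pi>"
proof -
  have "\<exists>K. \<forall>x\<in>W. norm (\<pi> a x) \<le> K * norm x" for a
    using star_repD(6)[OF assms(1)] by blast
  with assms show ?thesis
    by (simp add: star_rep_def)
qed

lemma star_rep_comp:
  assumes "star_rep UNIV \<rho>" and "unital_star_hom \<phi>"
  shows "star_rep UNIV (\<rho> \<circ> \<phi>)"
  using assms by (simp add: star_rep_def unital_star_hom_def)

text \<open>With \<open>c\<close> a self-adjoint square root of
  \<open>1 - a\<^sup>\<star> * a\<close>, the square of \<open>norm x\<close> is the sum of the
  squares of the norms of \<open>\<pi> c x\<close> and \<open>\<pi> a x\<close>.\<close>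

lemma norm_star_rep_unit_ball:
  assumes rep: "star_rep UNIV \<pi>" and a: "norm a < 1"
  shows "norm (\<pi> a x) \<le> norm x"
proof -
  note R = star_repD[OF rep, simplified]
  have h: "(a\<^sup>\<star> * a)\<^sup>\<star> = a\<^sup>\<star> * a" "norm (a\<^sup>\<star> * a) < 1"
    using a by (auto simp: cstar_mult cstar_cstar norm_cstar_mult power_less_one_iff)
  obtain c where c: "c\<^sup>\<star> = c" "c * c = 1 - a\<^sup>\<star> * a"
    using selfadjoint_sqrt_one_minus[OF h] .
  have "x = \<pi> (c * c) x + \<pi> (a\<^sup>\<star> * a) x"
    using R(7)[of "c * c" "a\<^sup>\<star> * a" x] R(10) by (simp add: c)
  then have "cinner x x = cinner x (\<pi> (c\<^sup>\<star> * c) x) + cinner x (\<pi> (a\<^sup>\<star> * a) x)"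
    by (metis c(1) cinner_add_right)
  also have "\<dots> = cinner (\<pi> c x) (\<pi> c x) + cinner (\<pi> a x) (\<pi> a x)"
    by (simp only: R(9,11))
  finally have "complex_of_real ((norm x)\<^sup>2) = complex_of_real ((norm (\<pi> c x))\<^sup>2 + (norm (\<pi> a x))\<^sup>2)"
    by (simp add: cinner_self)
  then have "(norm (\<pi> a x))\<^sup>2 \<le> (norm x)\<^sup>2"
    unfolding of_real_eq_iff by simp
  then show ?thesis
    by (simp add: power2_le_iff_abs_le)
qed

text \<open>\<open>star_rep\<close> bounds each operator \<open>\<pi> a\<close> separately, whereas
  continuity in \<open>a\<close> needs a bound linear in \<open>norm a\<close>. Dividing
  \<open>a\<close> by twice its norm puts it into the open unit ball, whence the constant 2.\<close>

lemma norm_star_rep_le: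
  assumes rep: "star_rep UNIV \<pi>"
  shows "norm (\<pi> a x) \<le> 2 * norm x * norm a"
proof (cases "a = 0")
  case True
  have "\<pi> 0 x = 0"
    using star_repD(7)[OF rep, of x 0 0] by simp
  with True show ?thesis by simp
next
  case False
  note R = star_repD[OF rep, simplified]
  define r where "r = complex_of_real (2 * norm a)"
  have r: "r \<noteq> 0" "cmod r = 2 * norm a"
    using False by (auto simp: r_def norm_mult)
  have "norm (\<pi> (inverse r *\<^sub>C a) x) \<le> norm x"
    using False by (intro norm_star_rep_unit_ball[OF rep]) (simp add: norm_scaleC norm_inverse r)
  moreover have "\<pi> a x = r *\<^sub>C \<pi> (inverse r *\<^sub>C a) x"
    using r by (simp add: R(8) scaleC_scaleC scaleC_one)
  ultimately show ?thesis
    by (simp add: norm_scaleC_hilbert r mult.commute[of "norm x"] mult_left_mono)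
qed

lemma continuous_on_star_rep_algebra:
  assumes "star_rep UNIV \<pi>"
  shows "continuous_on UNIV (\<lambda>a. \<pi> a x)"
  using star_repD(7)[OF assms] norm_star_rep_le[OF assms]
  by (intro continuous_additive_bounded) auto

lemma continuous_on_star_rep_space:
  assumes "star_rep UNIV \<pi>"
  shows "continuous_on UNIV (\<pi> a)"
proof -
  obtain K where "\<And>x. norm (\<pi> a x) \<le> K * norm x"
    using star_repD(6)[OF assms] by blast
  then show ?thesis
    using star_repD(4)[OF assms] by (intro continuous_additive_bounded) auto
qed

section \<open>Representations of the Cuntz algebra\<close>

text \<open>Elements of the free algebra evaluate to finite combinations of words in the generators
  and their adjoints. These lie in \<open>A\<close>, and they are dense.\<close>

lemma cuntz_algebra_induct:
  fixes s :: "nat \<Rightarrow> 'a::cstar_algebra"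
  assumes cuntz: "cuntz_algebra N s"
    and A: "closed A" "csubspace A"
    and one: "1 \<in> A" and mult: "\<And>a b. a \<in> A \<Longrightarrow> b \<in> A \<Longrightarrow> a * b \<in> A"
    and gen: "\<And>i. i \<in> {1..N} \<Longrightarrow> s i \<in> A" "\<And>i. i \<in> {1..N} \<Longrightarrow> (s i)\<^sup>\<star> \<in> A"
  shows "a \<in> A"
proof -
  have word: "prod_list (map (letter_eval s) ls) \<in> A"
    if "\<forall>l\<in>set ls. letter_index l \<in> {1..N}" for ls
    using that
  proof (induction ls)
    case Nil
    show ?case using one by simp
  next
    case (Cons l ls)
    then have "letter_eval s l \<in> A"
      using gen by (cases l) auto
    with Cons mult show ?case by simp
  qed
  have "free_eval s p \<in> A" if "p \<in> free_star_algebra N" for p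
    unfolding free_eval_def using that
    by (intro complex_vector.subspace_sum[OF A(2)] complex_vector.subspace_scale[OF A(2)] word)
       (auto simp: free_star_algebra_def)
  then have "closure (free_eval s ` free_star_algebra N) \<subseteq> A"
    by (intro closure_minimal A(1)) blast
  with cuntz show ?thesis
    unfolding cuntz_algebra_def by blast
qed

lemma gen_word_Nil [simp]: "gen_word s [] = 1"
  by (simp add: gen_word_def)

lemma gen_word_Cons [simp]: "gen_word s (i # K) = s i * gen_word s K"
  by (simp add: gen_word_def)

locale cuntz_rep =
  fixes N :: nat and s :: "nat \<Rightarrow> 'a::cstar_algebra"
    and \<pi> :: "'a \<Rightarrow> 'h::complex_hilbert_space \<Rightarrow> 'h"
  assumes rep: "star_rep UNIV \<pi>" and cuntz: "cuntz_algebra N s"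
begin

lemmas rep_adjoint = star_repD(11)[OF rep, OF UNIV_I UNIV_I]

lemma rep_zero_vec [simp]: "\<pi> a 0 = 0"
  using star_repD(4)[OF rep, of 0 0 a] by simp

lemma rep_zero [simp]: "\<pi> 0 x = 0"
  using star_repD(7)[OF rep, of x 0 0] by simp

lemma rep_sum: "\<pi> (\<Sum>i\<in>A. f i) x = (\<Sum>i\<in>A. \<pi> (f i) x)"
  by (induction A rule: infinite_finite_induct) (simp_all add: star_repD(7)[OF rep])

lemma rep_mult: "\<pi> (a * b) x = \<pi> a (\<pi> b x)"
  by (simp add: star_repD(9)[OF rep])

lemma rep_one: "\<pi> 1 x = x"
  by (simp add: star_repD(10)[OF rep])

lemma gen_star_gen:
  assumes "i \<in> {1..N}" "j \<in> {1..N}"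
  shows "\<pi> ((s i)\<^sup>\<star>) (\<pi> (s j) x) = (if i = j then x else 0)"
proof -
  have "(s i)\<^sup>\<star> * s j = (if i = j then 1 else 0)"
    using cuntz assms unfolding cuntz_algebra_def cuntz_relations_def by blast
  then show ?thesis
    by (simp add: rep_mult[symmetric] rep_one)
qed

lemma sum_gen_gen_star: "(\<Sum>i=1..N. \<pi> (s i) (\<pi> ((s i)\<^sup>\<star>) x)) = x"
proof -
  have "(\<Sum>i=1..N. s i * (s i)\<^sup>\<star>) = 1"
    using cuntz unfolding cuntz_algebra_def cuntz_relations_def by blast
  then show ?thesis
    by (simp add: rep_mult[symmetric] rep_sum[symmetric] rep_one)
qed

lemma cinner_gen_gen:
  assumes "i \<in> {1..N}" "j \<in> {1..N}"
  shows "cinner (\<pi> (s i) x) (\<pi> (s j) y) = (if i = j then cinner x y else 0)"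
  using gen_star_gen[OF assms] by (simp add: rep_adjoint)

lemma gen_word_star_gen_word:
  assumes "set K \<subseteq> {1..N}"
  shows "\<pi> ((gen_word s K)\<^sup>\<star>) (\<pi> (gen_word s K) x) = x"
  using assms
proof (induction K arbitrary: x)
  case (Cons i K)
  then show ?case
    by (simp add: cstar_mult rep_mult gen_star_gen)
qed (simp add: rep_one)

text \<open>The algebra elements that leave the closed span invariant form a closed unital
  subalgebra, so generators and their adjoints suffice; for a single operator it is enough to look
  at \<open>C\<close>.\<close>

lemma closure_cspan_invariant:
  assumes gen: "\<And>i x. i \<in> {1..N} \<Longrightarrow> x \<in> C \<Longrightarrow> \<pi> (s i) x \<in> closure (cspan C)"
    and star: "\<And>i x. i \<in> {1..N} \<Longrightarrow> x \<in> C \<Longrightarrow> \<pi> ((s i)\<^sup>\<star>) x \<in> closure (cspan C)"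
    and x: "x \<in> closure (cspan C)"
  shows "\<pi> a x \<in> closure (cspan C)"
proof -
  define W where "W = closure (cspan C)"
  have W: "closed W" "csubspace W"
    by (simp_all add: W_def csubspace_closure_cspan)
  have ext: "\<pi> a x \<in> W" if "\<And>x. x \<in> C \<Longrightarrow> \<pi> a x \<in> W" "x \<in> W" for a x
  proof -
    have "closure (cspan C) \<subseteq> \<pi> a -` W"
    proof (rule closure_cspan_subset)
      show "csubspace (\<pi> a -` W)"
        using W(2) by (simp add: complex_vector.subspace_def star_repD(4,5)[OF rep])
    qed (use that(1) closed_vimage[OF W(1) continuous_on_star_rep_space[OF rep]] in auto)
    with that(2) show ?thesis
      unfolding W_def by blast
  qed
  define A where "A = {a. \<forall>x\<in>W. \<pi> a x \<in> W}"
  have "a \<in> A"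
  proof (rule cuntz_algebra_induct[OF cuntz])
    \<comment> \<open>Here the automatic continuity of representations enters: each condition on
      \<open>a\<close> is closed because \<open>a \<mapsto> \<pi> a x\<close> is continuous.\<close>
    have "A = (\<Inter>x\<in>W. (\<lambda>a. \<pi> a x) -` W)"
      by (auto simp: A_def)
    then show "closed A"
      by (simp add: closed_INT closed_vimage[OF W(1) continuous_on_star_rep_algebra[OF rep]])
    show "csubspace A"
      using W(2) by (simp add: A_def complex_vector.subspace_def star_repD(7,8)[OF rep])
    show "s i \<in> A" "(s i)\<^sup>\<star> \<in> A" if "i \<in> {1..N}" for i
      unfolding A_def using gen[OF that] star[OF that] ext by (fold W_def) blast+
  qed (auto simp: A_def rep_one rep_mult)
  with x show ?thesis
    by (simp add: A_def W_def)
qed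

text \<open>On a permutative basis exactly one summand is nonzero, so \<open>shift\<close> inverts all the
  branching maps simultaneously.\<close>

definition shift :: "'h \<Rightarrow> 'h" where
  "shift x = (\<Sum>i=1..N. \<pi> ((s i)\<^sup>\<star>) x)"

lemma shift_gen:
  assumes "i \<in> {1..N}"
  shows "shift (\<pi> (s i) x) = x"
proof -
  have "shift (\<pi> (s i) x) = (\<Sum>j=1..N. if j = i then x else 0)"
    unfolding shift_def using assms by (intro sum.cong gen_star_gen) auto
  with assms show ?thesis by simp
qed

lemma shift_gen_word:
  assumes "set K \<subseteq> {1..N}"
  shows "(shift ^^ length K) (\<pi> (gen_word s K) x) = x"
  using assms
proof (induction K arbitrary: x)
  case (Cons i K)
  then show ?case
    by (simp add: rep_mult shift_gen funpow_Suc_right del: funpow.simps)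
qed (simp add: rep_one)

text \<open>The shift acts as \<open>\<pi>\<close> of the sum of all
  \<open>(s i)\<^sup>\<star>\<close>.\<close>

lemma shift_range: "x \<in> range (\<lambda>a. \<pi> a y) \<Longrightarrow> shift x \<in> range (\<lambda>a. \<pi> a y)"
  by (auto simp: shift_def rep_sum[symmetric] rep_mult[symmetric])

end

section \<open>Permutative bases\<close>

locale cuntz_basis = cuntz_rep N s \<pi>
  for N and s :: "nat \<Rightarrow> 'a::cstar_algebra"
    and \<pi> :: "'a \<Rightarrow> 'h::complex_hilbert_space \<Rightarrow> 'h" +
  fixes B :: "'h set"
  assumes orthonormal: "orthonormal_family B (\<lambda>x. x)"
    and total: "closure (cspan B) = UNIV"
    and gen_closed: "\<And>i b. i \<in> {1..N} \<Longrightarrow> b \<in> B \<Longrightarrow> \<pi> (s i) b \<in> B"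
begin

lemma cinner_basis: "x \<in> B \<Longrightarrow> y \<in> B \<Longrightarrow> cinner x y = (if x = y then 1 else 0)"
  using orthonormal by (simp add: orthonormal_family_def)

lemma norm_basis: "x \<in> B \<Longrightarrow> norm x = 1"
  using cinner_basis[of x x] norm_ge_zero[of x]
  by (auto simp: cinner_self power2_eq_1_iff simp del: of_real_power)

text \<open>A basis vector outside all images \<open>\<pi> (s i)\<close> of the basis would be
  orthogonal to them. Every \<open>\<pi> ((s i)\<^sup>\<star>) b\<close> would then be orthogonal to
  a total set, hence zero, and the sum relation would give \<open>b = 0\<close>.\<close>

lemma basis_in_gen_image:
  assumes b: "b \<in> B"
  obtains i where "i \<in> {1..N}" "shift b \<in> B" "b = \<pi> (s i) (shift b)"
proof -
  have "\<exists>i\<in>{1..N}. \<exists>c\<in>B. b = \<pi> (s i) c"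
  proof (rule ccontr)
    assume none: "\<not> ?thesis"
    have "\<pi> ((s i)\<^sup>\<star>) b = 0" if i: "i \<in> {1..N}" for i
    proof (rule orthogonal_total_eq_zero[OF total])
      fix c assume c: "c \<in> B"
      then have "cinner b (\<pi> (s i) c) = 0"
        using none i b gen_closed cinner_basis by auto
      then show "cinner (\<pi> ((s i)\<^sup>\<star>) b) c = 0"
        by (simp add: rep_adjoint cstar_cstar)
    qed
    then have "b = 0"
      using sum_gen_gen_star[of b] by simp
    with norm_basis[OF b] show False by simp
  qed
  then obtain i c where "i \<in> {1..N}" "c \<in> B" "b = \<pi> (s i) c" by blast
  then show ?thesis
    using shift_gen[of i c] by (intro that[of i]) auto
qed

text \<open>The generators have mutually orthogonal ranges, so for \<open>b\<close> in
  \<open>B\<close> only one index qualifies and \<open>SOME\<close> involves no choice.\<close>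

definition branch :: "'h \<Rightarrow> nat" where
  "branch b = (SOME i. i \<in> {1..N} \<and> b = \<pi> (s i) (shift b))"

lemma branch:
  assumes "b \<in> B"
  shows "branch b \<in> {1..N}" "\<pi> (s (branch b)) (shift b) = b"
proof -
  have "\<exists>i. i \<in> {1..N} \<and> b = \<pi> (s i) (shift b)"
    using basis_in_gen_image[OF assms] by blast
  from someI_ex[OF this] show "branch b \<in> {1..N}" "\<pi> (s (branch b)) (shift b) = b"
    by (auto simp: branch_def)
qed

lemma shift_basis: "b \<in> B \<Longrightarrow> shift b \<in> B"
  using basis_in_gen_image by blast

lemma funpow_shift_basis: "b \<in> B \<Longrightarrow> (shift ^^ n) b \<in> B"
  by (induction n) (simp_all add: shift_basis)

lemma gen_star_basis:
  assumes "i \<in> {1..N}" "b \<in> B"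
  shows "\<pi> ((s i)\<^sup>\<star>) b = (if i = branch b then shift b else 0)"
  using gen_star_gen[OF assms(1) branch(1)[OF assms(2)], of "shift b"] branch(2)[OF assms(2)]
  by simp

text \<open>Each branch index undoes one shift. The start \<open>l\<close> stays arbitrary because
  removing the first letter advances it, and because the suffixes of a cycle word start at any
  \<open>l\<close>.\<close>

lemma gen_word_branches:
  assumes "b \<in> B"
  shows "\<pi> (gen_word s (map (\<lambda>j. branch ((shift ^^ j) b)) [l..<l + d])) ((shift ^^ (l + d)) b)
    = (shift ^^ l) b"
proof (induction d arbitrary: l)
  case (Suc d)
  show ?case
    using Suc[of "Suc l"] branch(2)[OF funpow_shift_basis[OF assms, of l]]
    by (simp add: upt_conv_Cons rep_mult del: upt_Suc)
qed (simp add: rep_one)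

section \<open>Tail classes and the subrepresentations they span\<close>

definition tail_class :: "'h \<Rightarrow> 'h set" where
  "tail_class b = {x \<in> B. \<exists>m n. (shift ^^ m) x = (shift ^^ n) b}"

lemma tail_class_self: "b \<in> B \<Longrightarrow> b \<in> tail_class b"
  by (auto simp: tail_class_def)

lemma tail_class_subset: "tail_class b \<subseteq> B"
  by (auto simp: tail_class_def)

lemma tail_class_trans:
  assumes "(shift ^^ m) x = (shift ^^ n) y" "(shift ^^ p) y = (shift ^^ q) z"
  shows "(shift ^^ (p + m)) x = (shift ^^ (n + q)) z"
proof -
  have "(shift ^^ (p + m)) x = (shift ^^ (p + n)) y"
    using assms(1) by (simp add: funpow_add)
  also have "\<dots> = (shift ^^ (n + q)) z"
    using assms(2) by (subst add.commute) (simp add: funpow_add)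
  finally show ?thesis .
qed

lemma tail_class_eq:
  assumes "(shift ^^ m) x = (shift ^^ n) y"
  shows "tail_class x = tail_class y"
  using tail_class_trans assms assms[symmetric] unfolding tail_class_def by blast

definition class_space :: "'h \<Rightarrow> 'h set" where
  "class_space b = closure (cspan (tail_class b))"

text \<open>A generator puts one more step in front of a shift orbit; an adjoint either kills a
  basis vector or moves it one step along its orbit. Both respect the tail class.\<close>

lemma class_space_invariant:
  assumes "x \<in> class_space b"
  shows "\<pi> a x \<in> class_space b"
  using assms unfolding class_space_def
proof (rule closure_cspan_invariant[rotated 2])
  fix i x assume i: "i \<in> {1..N}" and x: "x \<in> tail_class b"
  then have xB: "x \<in> B" and "\<exists>m n. (shift ^^ m) x = (shift ^^ n) b"
    by (auto simp: tail_class_def)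
  then obtain m n where mn: "(shift ^^ m) x = (shift ^^ n) b" by blast
  have "(shift ^^ Suc m) (\<pi> (s i) x) = (shift ^^ n) b"
    using mn i by (simp add: funpow_Suc_right shift_gen del: funpow.simps)
  then have "\<pi> (s i) x \<in> tail_class b"
    using gen_closed[OF i xB] unfolding tail_class_def by blast
  then show "\<pi> (s i) x \<in> closure (cspan (tail_class b))"
    using subset_closure_cspan by blast
  have "(shift ^^ m) (shift x) = (shift ^^ Suc n) b"
    using mn by (simp add: funpow_swap1[symmetric])
  then have "shift x \<in> tail_class b"
    using shift_basis[OF xB] unfolding tail_class_def by blast
  then have "shift x \<in> closure (cspan (tail_class b))"
    using subset_closure_cspan by blast
  then show "\<pi> ((s i)\<^sup>\<star>) x \<in> closure (cspan (tail_class b))"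
    using complex_vector.subspace_0[OF csubspace_closure_cspan, of "tail_class b"]
    by (simp add: gen_star_basis[OF i xB])
qed

lemma star_rep_class_space: "star_rep (class_space b) \<pi>"
  by (intro star_rep_subrep[OF rep] class_space_invariant)
     (simp_all add: class_space_def csubspace_closure_cspan)

text \<open>From \<open>b\<close> one descends \<open>n\<close> shifts to the point where the two
  orbits meet and climbs back \<open>m\<close> branches to \<open>x\<close>; algebra elements effect
  both moves.\<close>

lemma cyclic_vector_class_space:
  assumes b: "b \<in> B"
  shows "cyclic_vector (class_space b) \<pi> b"
proof -
  let ?R = "range (\<lambda>a. \<pi> a b)"
  have b_in: "b \<in> class_space b"
    using tail_class_self[OF b] subset_closure_cspan unfolding class_space_def by blast
  have "csubspace ?R"
    unfolding complex_vector.subspace_def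
  proof (intro conjI ballI allI)
    show "0 \<in> ?R"
      using rep_zero[of b] by (metis rangeI)
    show "x + y \<in> ?R" if "x \<in> ?R" "y \<in> ?R" for x y
      using that by (auto simp: star_repD(7)[OF rep, OF UNIV_I, symmetric])
    show "c *\<^sub>C x \<in> ?R" if "x \<in> ?R" for c x
      using that by (auto simp: star_repD(8)[OF rep, OF UNIV_I, symmetric])
  qed
  moreover have "tail_class b \<subseteq> ?R"
  proof
    fix x assume "x \<in> tail_class b"
    then obtain m n where x: "x \<in> B" and mn: "(shift ^^ m) x = (shift ^^ n) b"
      by (auto simp: tail_class_def)
    have "b \<in> ?R"
      using rep_one[of b] by (metis rangeI)
    then have "(shift ^^ n) b \<in> ?R"
      by (induction n) (simp_all add: shift_range)
    then have "(shift ^^ m) x \<in> ?R"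
      by (simp only: mn)
    with x show "x \<in> ?R"
    proof (induction m arbitrary: x)
      case (Suc m)
      then have "shift x \<in> ?R"
        by (simp add: shift_basis funpow_swap1)
      then obtain a where "shift x = \<pi> a b" by blast
      then have "x = \<pi> (s (branch x) * a) b"
        using branch(2)[OF Suc.prems(1)] by (simp add: rep_mult)
      then show ?case by blast
    qed simp
  qed
  ultimately have "class_space b \<subseteq> closure ?R"
    unfolding class_space_def by (intro closure_mono complex_vector.span_minimal)
  moreover have "closure ?R \<subseteq> class_space b"
    using class_space_invariant[OF b_in]
    by (intro closure_minimal) (auto simp: class_space_def)
  ultimately show ?thesis
    using b_in by (auto simp: cyclic_vector_def)
qed

text \<open>Tail classes partition the basis, so distinct class spaces are closed spans of disjoint
  sets of orthonormal vectors, and together they contain the basis.\<close>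

lemma direct_sum_class_spaces:
  assumes "\<And>b. b \<in> B \<Longrightarrow> P (class_space b) \<pi>"
  shows "direct_sum_of P UNIV \<pi>"
  unfolding direct_sum_of_def
proof (intro conjI exI[of _ "class_space ` B"] rep)
  show "\<forall>W\<in>class_space ` B. star_rep W \<pi> \<and> P W \<pi>"
    using assms star_rep_class_space by blast
  show "\<forall>W\<in>class_space ` B. \<forall>W'\<in>class_space ` B.
      W \<noteq> W' \<longrightarrow> (\<forall>x\<in>W. \<forall>y\<in>W'. cinner x y = 0)"
  proof clarify
    fix b b' x y
    assume neq: "class_space b \<noteq> class_space b'"
      and xy: "x \<in> class_space b" "y \<in> class_space b'"
    have "cinner u v = 0" if "u \<in> tail_class b" "v \<in> tail_class b'" for u v
    proof -
      have "tail_class u = tail_class b" "tail_class v = tail_class b'"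
        using that tail_class_eq unfolding tail_class_def by blast+
      then have "u \<noteq> v"
        using neq by (auto simp: class_space_def)
      with that show ?thesis
        using cinner_basis[of u v] tail_class_subset by auto
    qed
    then show "cinner x y = 0"
      using xy unfolding class_space_def by (rule cinner_closure_cspan)
  qed
  have "B \<subseteq> \<Union> (class_space ` B)"
    using tail_class_self subset_closure_cspan unfolding class_space_def by blast
  then have "closure (cspan B) \<subseteq> closure (cspan (\<Union> (class_space ` B)))"
    by (intro closure_mono complex_vector.span_mono)
  then show "closure (cspan (\<Union> (class_space ` B))) = UNIV"
    unfolding total by (rule top.extremum_uniqueI)
qed

text \<open>The class also contains the periodic vector \<open>c = (shift ^^ m) b\<close>, which
  serves as cyclic vector; the branches along one turn of its orbit spell \<open>J\<close>.\<close>

lemma is_cycle_class_space: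
  assumes b: "b \<in> B" and k: "k > 0" and per: "(shift ^^ (m + k)) b = (shift ^^ m) b"
  shows "is_cycle N s (class_space b) \<pi>"
proof -
  define c where "c = (shift ^^ m) b"
  have c: "c \<in> B"
    using b by (simp add: c_def funpow_shift_basis)
  have space: "class_space b = class_space c"
    using tail_class_eq[of m b 0 c] by (simp add: class_space_def c_def)
  \<comment> \<open>The given \<open>k\<close> may be a proper multiple of the least period, and
    only within the least period are the orbit points distinct, hence orthonormal.\<close>
  define p where "p = (LEAST k. k > 0 \<and> (shift ^^ k) c = c)"
  have "k > 0 \<and> (shift ^^ k) c = c"
    using k per by (simp add: c_def funpow_add[symmetric] add.commute flip: comp_apply[of "shift ^^ k"])
  from LeastI[of "\<lambda>k. k > 0 \<and> (shift ^^ k) c = c", OF this]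
  have p: "p > 0" "(shift ^^ p) c = c"
    by (simp_all add: p_def)
  have minimal: "(shift ^^ j) c \<noteq> c" if "0 < j" "j < p" for j
    using not_less_Least[of j "\<lambda>k. k > 0 \<and> (shift ^^ k) c = c"] that by (simp add: p_def)
  have distinct: "(shift ^^ i) c \<noteq> (shift ^^ j) c" if "i < j" "j < p" for i j
  proof
    assume "(shift ^^ i) c = (shift ^^ j) c"
    \<comment> \<open>Advancing by \<open>p - j\<close> brings the right side back to
      \<open>c\<close>, so the left side returns to \<open>c\<close> before time
      \<open>p\<close>.\<close>
    then have "(shift ^^ (p - j + i)) c = (shift ^^ (p - j + j)) c"
      by (simp add: funpow_add)
    moreover have "p - j + j = p" "0 < p - j + i" "p - j + i < p"
      using that by auto
    ultimately show False
      using minimal p(2) by (simp only:)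
  qed
  define J where "J = map (\<lambda>j. branch ((shift ^^ j) c)) [0..<p]"
  have length_J: "length J = p"
    by (simp add: J_def)
  \<comment> \<open>The suffix of \<open>J\<close> from \<open>l\<close> on undoes the shifts from
    time \<open>l\<close> to time \<open>p\<close>, when the orbit is back at
    \<open>c\<close>.\<close>
  have word: "\<pi> (gen_word s (drop l J)) c = (shift ^^ l) c" if "l \<le> p" for l
    using gen_word_branches[OF c, of l "p - l"] that p by (simp add: J_def drop_map)
  have "set J \<subseteq> {1..N}"
    using branch(1)[OF funpow_shift_basis[OF c]] by (auto simp: J_def)
  moreover have "orthonormal_family {..<length J} (\<lambda>l. \<pi> (gen_word s (drop l J)) c)"
    unfolding orthonormal_family_def
  proof (intro ballI)
    fix i j assume "i \<in> {..<length J}" "j \<in> {..<length J}"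
    then show "cinner (\<pi> (gen_word s (drop i J)) c) (\<pi> (gen_word s (drop j J)) c)
        = (if i = j then 1 else 0)"
      using distinct[of i j] distinct[of j i] 
        cinner_basis[OF funpow_shift_basis funpow_shift_basis, OF c c, of i j]
      by (auto simp: word linorder_neq_iff length_J)
  qed
  moreover have "J \<noteq> []"
    using p by (simp add: J_def)
  ultimately have "P_finite N s J (class_space c) \<pi>"
    unfolding P_finite_def
    using star_rep_class_space cyclic_vector_class_space[OF c] norm_basis[OF c] word[of 0] by auto
  then show ?thesis
    unfolding is_cycle_def space by blast
qed

text \<open>The word of the first \<open>n\<close> branches carries \<open>(shift ^^ n) b\<close> to
  \<open>b\<close>, so its adjoint carries \<open>b\<close> to the \<open>n\<close>-th orbit point.
  Injectivity makes these points distinct basis vectors.\<close>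

lemma is_chain_class_space:
  assumes b: "b \<in> B" and inj: "inj (\<lambda>n. (shift ^^ n) b)"
  shows "is_chain N s (class_space b) \<pi>"
proof -
  \<comment> \<open>Letters are counted from 1 and shifts from 0, hence
    \<open>n - 1\<close>.\<close>
  define J where "J = (\<lambda>n. branch ((shift ^^ (n - 1)) b))"
  have J: "J n \<in> {1..N}" for n
    using branch(1)[OF funpow_shift_basis[OF b]] by (simp add: J_def)
  have star: "\<pi> ((gen_word s (map J [1..<Suc n]))\<^sup>\<star>) b = (shift ^^ n) b" for n
  proof -
    have "map J [1..<Suc n] = map (\<lambda>j. branch ((shift ^^ j) b)) [0..<0 + n]"
      by (simp add: J_def map_Suc_upt[symmetric] del: upt_Suc)
    then have "\<pi> (gen_word s (map J [1..<Suc n])) ((shift ^^ n) b) = b"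
      using gen_word_branches[OF b, of 0 n] by simp
    moreover have "set (map J [1..<Suc n]) \<subseteq> {1..N}"
      using J by auto
    note gen_word_star_gen_word[OF this, of "(shift ^^ n) b"]
    ultimately show ?thesis
      by (simp only:)
  qed
  have "orthonormal_family {1..} (\<lambda>n. \<pi> ((gen_word s (map J [1..<Suc n]))\<^sup>\<star>) b)"
    unfolding orthonormal_family_def star
    using inj by (auto simp: cinner_basis funpow_shift_basis b dest: injD)
  then have "P_infinite N s J (class_space b) \<pi>"
    unfolding P_infinite_def
    using J star_rep_class_space cyclic_vector_class_space[OF b] norm_basis[OF b] by blast
  then show ?thesis
    unfolding is_chain_def by blast
qed

end

text \<open>The labels are dropped in favour of the vectors \<open>e n\<close> themselves, on which
  the generators act as the branching maps.\<close>

lemma (in cuntz_rep) permutative_basis: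
  assumes "permutative N s UNIV \<pi>"
  obtains B where "cuntz_basis N s \<pi> B"
proof -
  obtain \<Lambda> :: "'h set" and e f where
      ortho: "orthonormal_family \<Lambda> e" and total: "closure (cspan (e ` \<Lambda>)) = UNIV"
      and f: "\<forall>i\<in>{1..N}. \<forall>n\<in>\<Lambda>. f i n \<in> \<Lambda> \<and> \<pi> (s i) (e n) = e (f i n)"
    using assms unfolding permutative_def by blast
  have "cuntz_basis N s \<pi> (e ` \<Lambda>)"
  proof
    show "orthonormal_family (e ` \<Lambda>) (\<lambda>x. x)"
      unfolding orthonormal_family_def
    proof clarify
      fix m n assume "m \<in> \<Lambda>" "n \<in> \<Lambda>"
      then have "cinner (e m) (e n) = (if m = n then 1 else 0)" "cinner (e n) (e n) = 1"
        using ortho by (simp_all add: orthonormal_family_def)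
      then show "cinner (e m) (e n) = (if e m = e n then 1 else 0)"
        by (cases "e m = e n") auto
    qed
  qed (use total f in auto)
  then show ?thesis by (rule that)
qed

lemma (in cuntz_basis) permutative: "permutative N s UNIV \<pi>"
  unfolding permutative_def using rep orthonormal total gen_closed
  by (intro conjI exI[of _ B] exI[of _ "\<lambda>x. x"] exI[of _ "\<lambda>i. \<pi> (s i)"]) simp_all

section \<open>Bases of cycles and chains\<close>

context cuntz_rep
begin

text \<open>One vector may come from many pairs \<open>(K, n)\<close>, since the sequences used
  satisfy \<open>\<pi> (s (c n)) (\<Omega> (Suc n)) = \<Omega> n\<close>. Taking the set of values
  absorbs this redundancy.\<close>

definition word_orbit :: "(nat \<Rightarrow> 'h) \<Rightarrow> 'h set" where
  "word_orbit \<Omega> = {\<pi> (gen_word s K) (\<Omega> n) | K n. set K \<subseteq> {1..N}}"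

lemma word_orbitI: "set K \<subseteq> {1..N} \<Longrightarrow> \<pi> (gen_word s K) (\<Omega> n) \<in> word_orbit \<Omega>"
  by (auto simp: word_orbit_def)

lemma word_orbit_base: "\<Omega> n \<in> word_orbit \<Omega>"
  using word_orbitI[of "[]" \<Omega> n] by (simp add: rep_one)

lemma word_orbit_gen:
  assumes "i \<in> {1..N}" "x \<in> word_orbit \<Omega>"
  shows "\<pi> (s i) x \<in> word_orbit \<Omega>"
proof -
  obtain K n where "set K \<subseteq> {1..N}" "x = \<pi> (gen_word s K) (\<Omega> n)"
    using assms(2) by (auto simp: word_orbit_def)
  then show ?thesis
    using assms(1) word_orbitI[of "i # K" \<Omega> n] by (simp add: rep_mult)
qed

text \<open>Two orbit vectors are equal or orthogonal by induction on the total length of their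
  words: leading generators are compared and stripped. Totality holds because the closed span is
  invariant and contains the cyclic vector \<open>\<xi>\<close>.\<close>

lemma word_orbit_basis:
  assumes c: "\<And>n. c n \<in> {1..N}" and step: "\<And>n. \<pi> (s (c n)) (\<Omega> (Suc n)) = \<Omega> n"
    and unit: "\<And>n. norm (\<Omega> n) = 1"
    and ortho: "\<And>m n. \<Omega> m = \<Omega> n \<or> cinner (\<Omega> m) (\<Omega> n) = 0"
    and \<xi>: "\<xi> \<in> word_orbit \<Omega>" and cyc: "cyclic_vector UNIV \<pi> \<xi>"
  shows "cuntz_basis N s \<pi> (word_orbit \<Omega>)"
proof
  have disj: "\<pi> (gen_word s K) (\<Omega> m) = \<pi> (gen_word s L) (\<Omega> n) \<or>
      cinner (\<pi> (gen_word s K) (\<Omega> m)) (\<pi> (gen_word s L) (\<Omega> n)) = 0"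
    if "set K \<subseteq> {1..N}" "set L \<subseteq> {1..N}" for K L m n
    using that
  proof (induction "length K + length L" arbitrary: K L m n rule: less_induct)
    case less
    \<comment> \<open>An empty word also gets a leading generator, by \<open>step\<close>, and its
      length stays 0 by truncated subtraction. The total length still drops unless both words are
      empty.\<close>
    have split: "\<exists>i\<in>{1..N}. \<exists>K' m'. set K' \<subseteq> {1..N} \<and> length K' = length K - 1 \<and>
        \<pi> (gen_word s K) (\<Omega> m) = \<pi> (s i) (\<pi> (gen_word s K') (\<Omega> m'))"
      if "set K \<subseteq> {1..N}" for K m
    proof (cases K)
      case Nil
      then show ?thesis
        using c[of m] step[of m]
        by (intro bexI[of _ "c m"] exI[of _ "[]"] exI[of _ "Suc m"]) (simp_all add: rep_one)
    next
      case (Cons i K')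
      then show ?thesis
        using that by (intro bexI[of _ i] exI[of _ K'] exI[of _ m]) (simp_all add: rep_mult)
    qed
    show ?case
    proof (cases "K = [] \<and> L = []")
      case True
      then show ?thesis
        using ortho by (simp add: rep_one)
    next
      case False
      obtain i K' m' where K: "i \<in> {1..N}" "set K' \<subseteq> {1..N}" "length K' = length K - 1"
          "\<pi> (gen_word s K) (\<Omega> m) = \<pi> (s i) (\<pi> (gen_word s K') (\<Omega> m'))"
        using split[OF less.prems(1)] by blast
      obtain j L' n' where L: "j \<in> {1..N}" "set L' \<subseteq> {1..N}" "length L' = length L - 1"
          "\<pi> (gen_word s L) (\<Omega> n) = \<pi> (s j) (\<pi> (gen_word s L') (\<Omega> n'))"
        using split[OF less.prems(2)] by blast
      have "length K' + length L' < length K + length L"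
        using False K(3) L(3) by (cases K; cases L) auto
      from less.hyps[OF this K(2) L(2), of m' n'] show ?thesis
        unfolding K(4) L(4) cinner_gen_gen[OF K(1) L(1)] by auto
    qed
  qed
  have norm_word: "cinner x x = 1" if "x \<in> word_orbit \<Omega>" for x
  proof -
    obtain K n where "set K \<subseteq> {1..N}" "x = \<pi> (gen_word s K) (\<Omega> n)"
      using \<open>x \<in> word_orbit \<Omega>\<close> by (auto simp: word_orbit_def)
    then show ?thesis
      using cinner_self[of "\<Omega> n"] by (simp add: rep_adjoint gen_word_star_gen_word unit)
  qed
  have eq_or_orth: "x = y \<or> cinner x y = 0" if "x \<in> word_orbit \<Omega>" "y \<in> word_orbit \<Omega>" for x y
    using that disj unfolding word_orbit_def by blast
  show "orthonormal_family (word_orbit \<Omega>) (\<lambda>x. x)"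
    unfolding orthonormal_family_def using norm_word eq_or_orth by auto
  show "\<pi> (s i) b \<in> word_orbit \<Omega>" if "i \<in> {1..N}" "b \<in> word_orbit \<Omega>" for i b
    using that by (rule word_orbit_gen)
  let ?W = "closure (cspan (word_orbit \<Omega>))"
  have "\<pi> a \<xi> \<in> ?W" for a
  proof (rule closure_cspan_invariant)
    fix i x assume i: "i \<in> {1..N}" and x: "x \<in> word_orbit \<Omega>"
    show "\<pi> (s i) x \<in> ?W"
      using word_orbit_gen[OF i x] subset_closure_cspan by blast
    obtain K n where K: "set K \<subseteq> {1..N}" "x = \<pi> (gen_word s K) (\<Omega> n)"
      using x by (auto simp: word_orbit_def)
    \<comment> \<open>Once \<open>x\<close> is a generator applied to another orbit vector, an
      adjoint sends it to that vector or to zero.\<close>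
    have "\<exists>j\<in>{1..N}. \<exists>y\<in>word_orbit \<Omega>. x = \<pi> (s j) y"
    proof (cases K)
      case Nil
      then show ?thesis
        using K c[of n] step[of n] word_orbit_base[of \<Omega> "Suc n"]
        by (intro bexI[of _ "c n"] bexI[of _ "\<Omega> (Suc n)"]) (simp_all add: rep_one)
    next
      case (Cons j K')
      then show ?thesis
        using K word_orbitI[of K' \<Omega> n]
        by (intro bexI[of _ j] bexI[of _ "\<pi> (gen_word s K') (\<Omega> n)"]) (simp_all add: rep_mult)
    qed
    then obtain j y where j: "j \<in> {1..N}" "y \<in> word_orbit \<Omega>" "x = \<pi> (s j) y"
      by blast
    have "y \<in> ?W" "0 \<in> ?W"
      using j(2) subset_closure_cspan[of "word_orbit \<Omega>"]
        complex_vector.subspace_0[OF csubspace_closure_cspan[of "word_orbit \<Omega>"]] by blast+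
    then show "\<pi> ((s i)\<^sup>\<star>) x \<in> ?W"
      unfolding j(3) gen_star_gen[OF i j(1)] by simp
  next
    show "\<xi> \<in> ?W"
      using \<xi> subset_closure_cspan by blast
  qed
  then have "closure (range (\<lambda>a. \<pi> a \<xi>)) \<subseteq> ?W"
    by (intro closure_minimal) auto
  then show "?W = UNIV"
    using cyc unfolding cyclic_vector_def by blast
qed

lemma funpow_shift_step:
  assumes c: "\<And>n. c n \<in> {1..N}" and step: "\<And>n. \<pi> (s (c n)) (\<Omega> (Suc n)) = \<Omega> n"
  shows "(shift ^^ m) (\<Omega> n) = \<Omega> (n + m)"
proof (induction m)
  case (Suc m)
  have "shift (\<Omega> (n + m)) = \<Omega> (Suc (n + m))"
    using shift_gen[OF c, of "n + m" "\<Omega> (Suc (n + m))"] by (simp only: step)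
  with Suc show ?case by simp
qed simp

lemma word_orbit_shift:
  assumes "b \<in> word_orbit \<Omega>"
  obtains m n where "(shift ^^ m) b = \<Omega> n"
  using assms shift_gen_word unfolding word_orbit_def by blast

text \<open>The finite orthonormal family is continued periodically through \<open>n mod k\<close>.
  Shifting off the letters of a word lands in this sequence, and from there \<open>k\<close> more
  shifts change nothing.\<close>

lemma cycle_basis:
  assumes "is_cycle N s UNIV \<pi>"
  obtains B where "cuntz_basis N s \<pi> B"
    and "\<And>b. b \<in> B \<Longrightarrow> \<exists>m k. k > 0 \<and> (shift ^^ (m + k)) b = (shift ^^ m) b"
proof -
  obtain J \<xi> where J: "J \<noteq> []" "set J \<subseteq> {1..N}" and cyc: "cyclic_vector UNIV \<pi> \<xi>"
      and fixed: "\<pi> (gen_word s J) \<xi> = \<xi>"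
      and ortho: "orthonormal_family {..<length J} (\<lambda>l. \<pi> (gen_word s (drop l J)) \<xi>)"
    using assms unfolding is_cycle_def P_finite_def by blast
  define k where "k = length J"
  define \<Omega> where "\<Omega> n = \<pi> (gen_word s (drop (n mod k) J)) \<xi>" for n
  define c where "c n = J ! (n mod k)" for n
  have k: "k > 0"
    using J by (simp add: k_def)
  have c: "c n \<in> {1..N}" for n
  proof -
    have "c n \<in> set J"
      unfolding c_def using k by (intro nth_mem) (simp add: k_def)
    with J(2) show ?thesis by blast
  qed
  have step: "\<pi> (s (c n)) (\<Omega> (Suc n)) = \<Omega> n" for n
  proof -
    \<comment> \<open>At the end of a turn the right side has the empty suffix while
      \<open>\<Omega>\<close> restarts with all of \<open>J\<close>; by \<open>fixed\<close> both
      give \<open>\<xi>\<close>.\<close>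
    have "\<Omega> (Suc n) = \<pi> (gen_word s (drop (Suc (n mod k)) J)) \<xi>"
      using fixed by (simp add: \<Omega>_def mod_Suc rep_one k_def)
    then show ?thesis
      using k by (simp add: \<Omega>_def c_def k_def Cons_nth_drop_Suc[symmetric] rep_mult)
  qed
  have inner: "cinner (\<Omega> m) (\<Omega> n) = (if m mod k = n mod k then 1 else 0)" for m n
    using ortho k by (simp add: orthonormal_family_def \<Omega>_def k_def)
  have unit: "norm (\<Omega> n) = 1" for n
    using inner[of n n] norm_ge_zero[of "\<Omega> n"]
    by (auto simp: cinner_self power2_eq_1_iff simp del: of_real_power)
  have \<Omega>0: "\<Omega> 0 = \<xi>"
    using fixed by (simp add: \<Omega>_def)
  show ?thesis
  proof
    show "cuntz_basis N s \<pi> (word_orbit \<Omega>)"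
    proof (rule word_orbit_basis[where c = c, OF c step unit])
      show "\<Omega> m = \<Omega> n \<or> cinner (\<Omega> m) (\<Omega> n) = 0" for m n
        unfolding inner by (simp add: \<Omega>_def)
      show "\<xi> \<in> word_orbit \<Omega>"
        using word_orbit_base[of \<Omega> 0] \<Omega>0 by simp
    qed (rule cyc)
    fix b assume "b \<in> word_orbit \<Omega>"
    then obtain m n where mn: "(shift ^^ m) b = \<Omega> n"
      by (rule word_orbit_shift)
    have "(shift ^^ (m + k)) b = (shift ^^ k) (\<Omega> n)"
      by (simp add: add.commute[of m] funpow_add mn)
    also have "\<dots> = \<Omega> (n + k)"
      by (rule funpow_shift_step[where c = c, OF c step])
    also have "\<dots> = (shift ^^ m) b"
      by (simp add: mn \<Omega>_def)
    finally show "\<exists>m k. k > 0 \<and> (shift ^^ (m + k)) b = (shift ^^ m) b"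
      using k by blast
  qed
qed

text \<open>This is the equality case of Cauchy-Schwarz: \<open>x\<close> and its projection
  \<open>\<pi> (s i) (\<pi> ((s i)\<^sup>\<star>) x)\<close> are unit vectors with inner product
  1.\<close>

lemma gen_gen_star_unit:
  assumes i: "i \<in> {1..N}" and "norm x = 1" "norm (\<pi> ((s i)\<^sup>\<star>) x) = 1"
  shows "\<pi> (s i) (\<pi> ((s i)\<^sup>\<star>) x) = x"
proof -
  define y where "y = \<pi> ((s i)\<^sup>\<star>) x"
  have xy: "cinner x (\<pi> (s i) y) = 1"
    using assms(3) cinner_self[of y] rep_adjoint[of "(s i)\<^sup>\<star>" x y]
    by (simp add: y_def cstar_cstar)
  then have "inner x (\<pi> (s i) y) = 1"
    by (simp add: inner_eq_Re_cinner)
  moreover have "cinner (\<pi> (s i) y) (\<pi> (s i) y) = 1"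
    using assms(3) cinner_self[of y] by (simp add: cinner_gen_gen[OF i i] y_def)
  then have "inner (\<pi> (s i) y) (\<pi> (s i) y) = 1"
    by (simp add: inner_eq_Re_cinner)
  moreover have "inner x x = 1"
    using assms(2) by (simp add: norm_eq_1)
  ultimately have "inner (\<pi> (s i) y - x) (\<pi> (s i) y - x) = 0"
    by (simp add: inner_diff_left inner_diff_right inner_commute)
  then show ?thesis
    by (simp add: y_def)
qed

text \<open>Since all \<open>\<Psi> n\<close> are unit vectors, each generator undoes the adjoint
  that produced the next one, so the sequence is a shift orbit. Every vector of the word orbit runs
  into its orthonormal part, which makes its own shift orbit injective.\<close>

lemma chain_basis:
  assumes "is_chain N s UNIV \<pi>"
  obtains B where "cuntz_basis N s \<pi> B"
    and "\<And>b. b \<in> B \<Longrightarrow> inj (\<lambda>n. (shift ^^ n) b)"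
proof -
  obtain J \<xi> where J: "\<And>n. n \<ge> 1 \<Longrightarrow> J n \<in> {1..N}" and \<xi>: "norm \<xi> = 1"
      and cyc: "cyclic_vector UNIV \<pi> \<xi>"
      and ortho: "orthonormal_family {1..} (\<lambda>n. \<pi> ((gen_word s (map J [1..<Suc n]))\<^sup>\<star>) \<xi>)"
    using assms unfolding is_chain_def P_infinite_def by blast
  define \<Psi> where "\<Psi> n = \<pi> ((gen_word s (map J [1..<Suc n]))\<^sup>\<star>) \<xi>" for n
  \<comment> \<open>The given family is orthonormal from index 1 on, so \<open>\<Omega>\<close>
    starts at \<open>\<Psi> 1\<close>.\<close>
  define \<Omega> where "\<Omega> n = \<Psi> (Suc n)" for n
  have \<Psi>0: "\<Psi> 0 = \<xi>"
    by (simp add: \<Psi>_def rep_one)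
  have \<Psi>_Suc: "\<Psi> (Suc n) = \<pi> ((s (J (Suc n)))\<^sup>\<star>) (\<Psi> n)" for n
    by (simp add: \<Psi>_def gen_word_def cstar_mult rep_mult)
  have inner: "cinner (\<Omega> m) (\<Omega> n) = (if m = n then 1 else 0)" for m n
    using ortho by (simp add: orthonormal_family_def \<Omega>_def \<Psi>_def del: upt_Suc)
  have unit: "norm (\<Omega> n) = 1" for n
    using inner[of n n] norm_ge_zero[of "\<Omega> n"]
    by (auto simp: cinner_self power2_eq_1_iff simp del: of_real_power)
  have unit': "norm (\<Psi> n) = 1" for n
    using unit \<xi> \<Psi>0 by (cases n) (auto simp: \<Omega>_def)
  have step': "\<pi> (s (J (Suc n))) (\<Psi> (Suc n)) = \<Psi> n" for n
    using gen_gen_star_unit[of "J (Suc n)" "\<Psi> n"] J[of "Suc n"] unit'[of n] unit'[of "Suc n"]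
    by (simp add: \<Psi>_Suc)
  define c where "c n = J (Suc (Suc n))" for n
  have c: "c n \<in> {1..N}" for n
    unfolding c_def by (rule J) simp
  have step: "\<pi> (s (c n)) (\<Omega> (Suc n)) = \<Omega> n" for n
    unfolding c_def \<Omega>_def by (rule step')
  have inj_\<Omega>: "\<Omega> m = \<Omega> n \<Longrightarrow> m = n" for m n
    using inner[of m n] inner[of n n] by (auto split: if_splits)
  show ?thesis
  proof
    show "cuntz_basis N s \<pi> (word_orbit \<Omega>)"
    proof (rule word_orbit_basis[where c = c, OF c step unit])
      show "\<Omega> m = \<Omega> n \<or> cinner (\<Omega> m) (\<Omega> n) = 0" for m n
        unfolding inner by simp
      show "\<xi> \<in> word_orbit \<Omega>"
        \<comment> \<open>The cyclic vector precedes the sequence \<open>\<Omega>\<close>: it is the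
          generator with index \<open>J 1\<close> applied to \<open>\<Omega> 0\<close>.\<close>
        using word_orbit_gen[OF J word_orbit_base[of \<Omega> 0], of 1] step'[of 0]
        by (simp add: \<Omega>_def \<Psi>0)
    qed (rule cyc)
    fix b assume "b \<in> word_orbit \<Omega>"
    then obtain p q where pq: "(shift ^^ p) b = \<Omega> q"
      by (rule word_orbit_shift)
    have shift_p: "(shift ^^ p) ((shift ^^ n) b) = \<Omega> (q + n)" for n
    proof -
      have "(shift ^^ p) ((shift ^^ n) b) = (shift ^^ (p + n)) b"
        by (simp add: funpow_add)
      also have "\<dots> = (shift ^^ n) ((shift ^^ p) b)"
        by (subst add.commute) (simp add: funpow_add)
      also have "\<dots> = \<Omega> (q + n)"
        unfolding pq by (rule funpow_shift_step[where c = c, OF c step])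
      finally show ?thesis .
    qed
    show "inj (\<lambda>n. (shift ^^ n) b)"
    proof (rule injI)
      fix m n assume "(shift ^^ m) b = (shift ^^ n) b"
      then have "\<Omega> (q + m) = \<Omega> (q + n)"
        by (simp only: shift_p[symmetric])
      then show "m = n"
        using inj_\<Omega> by fastforce
    qed
  qed
qed

end

section \<open>Tensor products\<close>

text \<open>One slot is extended at a time, first the second with \<open>x\<close> in
  \<open>A\<close>, then the first. Each slot is continuous because
  \<open>norm (S x y) = norm x * norm y\<close>.\<close>

lemma hilbert_tensor_total:
  assumes S: "hilbert_tensor S"
    and "closure (cspan A) = UNIV" and "closure (cspan B) = UNIV"
  shows "closure (cspan {S x y | x y. x \<in> A \<and> y \<in> B}) = UNIV"
proof -
  define W where "W = closure (cspan {S x y | x y. x \<in> A \<and> y \<in> B})"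
  have W: "closed W" "csubspace W"
    by (simp_all add: W_def csubspace_closure_cspan)
  have bilin: "S (x + x') y = S x y + S x' y" "S x (y + y') = S x y + S x y'"
      "S (c *\<^sub>C x) y = c *\<^sub>C S x y" "S x (c *\<^sub>C y) = c *\<^sub>C S x y" for x x' y y' c
    using S unfolding hilbert_tensor_def cbilinear_def by blast+
  have norm: "norm (S x y) = norm x * norm y" for x y
  proof -
    have "cinner (S x y) (S x y) = cinner x x * cinner y y"
      using S unfolding hilbert_tensor_def by blast
    then have "complex_of_real ((norm (S x y))\<^sup>2) = complex_of_real ((norm x * norm y)\<^sup>2)"
      by (simp add: cinner_self power_mult_distrib)
    then have "(norm (S x y))\<^sup>2 = (norm x * norm y)\<^sup>2"
      unfolding of_real_eq_iff .
    then show ?thesis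
      by (simp add: power2_eq_iff_nonneg)
  qed
  have zero: "S 0 y = 0" "S x 0 = 0" for x y
    using bilin(1)[of 0 0 y] bilin(2)[of x 0 0] by simp_all
  have 1: "S x y \<in> W" if "x \<in> A" for x y
  proof -
    have "closed (S x -` W)"
      by (intro closed_vimage[OF W(1)] continuous_additive_bounded[of _ "norm x"])
         (simp_all add: bilin norm)
    moreover have "csubspace (S x -` W)"
      using W(2) by (simp add: complex_vector.subspace_def bilin zero)
    moreover have "B \<subseteq> S x -` W"
      using that subset_closure_cspan[of "{S x y | x y. x \<in> A \<and> y \<in> B}"]
      unfolding W_def by blast
    ultimately have "closure (cspan B) \<subseteq> S x -` W"
      by (intro closure_cspan_subset)
    then show ?thesis
      unfolding assms(3) by blast
  qed
  have 2: "S x y \<in> W" for x y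
  proof -
    have "closed ((\<lambda>x. S x y) -` W)"
      by (intro closed_vimage[OF W(1)] continuous_additive_bounded[of _ "norm y"])
         (simp_all add: bilin norm)
    moreover have "csubspace ((\<lambda>x. S x y) -` W)"
      using W(2) by (simp add: complex_vector.subspace_def bilin zero)
    moreover have "A \<subseteq> (\<lambda>x. S x y) -` W"
      using 1 by blast
    ultimately have "closure (cspan A) \<subseteq> (\<lambda>x. S x y) -` W"
      by (intro closure_cspan_subset)
    then show ?thesis
      unfolding assms(2) by blast
  qed
  have "closure (cspan {S x y | x y. True}) \<subseteq> W"
    using 2 by (intro closure_cspan_subset W) blast
  moreover have "closure (cspan {S x y | x y. True}) = UNIV"
    using S unfolding hilbert_tensor_def by blast
  ultimately show ?thesis
    unfolding W_def by blast
qed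

text \<open>Enlarging the preperiod and multiplying the period lets two orbits share both.\<close>

lemma funpow_eventually_periodic:
  fixes f :: "'a \<Rightarrow> 'a"
  assumes "(f ^^ (m + k)) x = (f ^^ m) x" and "m \<le> n"
  shows "(f ^^ (n + k * q)) x = (f ^^ n) x"
proof -
  obtain d where n: "n = d + m"
    using assms(2) by (metis add.commute le_Suc_ex)
  have "(f ^^ (d + (m + k))) x = (f ^^ (d + m)) x"
    using assms(1) by (simp only: funpow_add[where m = d] comp_apply)
  then have per: "(f ^^ (n + k)) x = (f ^^ n) x"
    by (simp only: n add.assoc)
  show ?thesis
  proof (induction q)
    case (Suc q)
    have "(f ^^ (n + k * Suc q)) x = (f ^^ (k * q)) ((f ^^ (n + k)) x)"
      by (simp add: funpow_add[symmetric] algebra_simps flip: comp_apply[of "f ^^ (k * q)"])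
    also have "\<dots> = (f ^^ (n + k * q)) x"
      unfolding per by (simp add: funpow_add[symmetric] algebra_simps flip: comp_apply[of "f ^^ (k * q)"])
    finally show ?case
      using Suc by simp
  qed simp
qed

section \<open>The product representation on the Hilbert space tensor product\<close>

locale cuntz_tensor =
  left: cuntz_rep N t \<pi>\<^sub>1 + right: cuntz_rep M r \<pi>\<^sub>2
  for N and t :: "nat \<Rightarrow> 'a::cstar_algebra"
    and \<pi>\<^sub>1 :: "'a \<Rightarrow> 'h::complex_hilbert_space \<Rightarrow> 'h"
    and M and r :: "nat \<Rightarrow> 'b::cstar_algebra"
    and \<pi>\<^sub>2 :: "'b \<Rightarrow> 'k::complex_hilbert_space \<Rightarrow> 'k" +
  fixes s :: "nat \<Rightarrow> 'c::cstar_algebra" and T :: "'a \<Rightarrow> 'b \<Rightarrow> 'd::cstar_algebra"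
    and \<phi> :: "'c \<Rightarrow> 'd" and S :: "'h \<Rightarrow> 'k \<Rightarrow> 'l::complex_hilbert_space"
    and \<rho> :: "'d \<Rightarrow> 'l \<Rightarrow> 'l"
  assumes cuntz_product: "cuntz_algebra (N * M) s"
    and embedding: "cuntz_embedding N M t r s T \<phi>"
    and hilbert: "hilbert_tensor S"
    and tensor: "tensor_rep T S \<pi>\<^sub>1 \<pi>\<^sub>2 \<rho>"
begin

sublocale prod: cuntz_rep "N * M" s "\<rho> \<circ> \<phi>"
  using cuntz_product embedding tensor
  by unfold_locales (auto simp: cuntz_embedding_def tensor_rep_def intro: star_rep_comp)

lemma cinner_tensor: "cinner (S x y) (S x' y') = cinner x x' * cinner y y'"
  using hilbert unfolding hilbert_tensor_def by blast

lemma gen_index: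
  assumes "i \<in> {1..N}" "j \<in> {1..M}"
  shows "M * (i - 1) + j \<in> {1..N * M}"
proof -
  obtain i' where i': "i = Suc i'" "Suc i' \<le> N"
    using assms(1) by (cases i) auto
  then have "M * i' + M \<le> N * M"
    using mult_le_mono1[of "Suc i'" N M] by (simp add: algebra_simps)
  with assms(2) i' show ?thesis by auto
qed

text \<open>This is division of \<open>k - 1\<close> by \<open>M\<close> with remainder, all indices
  being counted from 1.\<close>

lemma gen_index_cases:
  assumes "k \<in> {1..N * M}"
  obtains i j where "i \<in> {1..N}" "j \<in> {1..M}" "k = M * (i - 1) + j"
proof
  have M: "M > 0"
    using assms by (cases M) auto
  have "(k - 1) div M < N"
    using assms by (intro less_mult_imp_div_less) auto
  then show "(k - 1) div M + 1 \<in> {1..N}" by simp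
  show "(k - 1) mod M + 1 \<in> {1..M}"
    using M by (simp add: Suc_leI)
  show "k = M * ((k - 1) div M + 1 - 1) + ((k - 1) mod M + 1)"
    using assms mult_div_mod_eq[of M "k - 1"] by simp
qed

lemma gen_tensor:
  assumes "i \<in> {1..N}" "j \<in> {1..M}"
  shows "(\<rho> \<circ> \<phi>) (s (M * (i - 1) + j)) (S x y) = S (\<pi>\<^sub>1 (t i) x) (\<pi>\<^sub>2 (r j) y)"
proof -
  have "\<phi> (s (M * (i - 1) + j)) = T (t i) (r j)"
    using embedding assms unfolding cuntz_embedding_def by blast
  then show ?thesis
    using tensor by (simp add: tensor_rep_def)
qed

definition tensor_basis :: "'h set \<Rightarrow> 'k set \<Rightarrow> 'l set" where
  "tensor_basis A B = {S x y | x y. x \<in> A \<and> y \<in> B}"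

lemma cuntz_basis_tensor:
  assumes "cuntz_basis N t \<pi>\<^sub>1 A" and "cuntz_basis M r \<pi>\<^sub>2 B"
  shows "cuntz_basis (N * M) s (\<rho> \<circ> \<phi>) (tensor_basis A B)"
proof -
  interpret A: cuntz_basis N t \<pi>\<^sub>1 A by fact
  interpret B: cuntz_basis M r \<pi>\<^sub>2 B by fact
  show ?thesis
  proof
    show "orthonormal_family (tensor_basis A B) (\<lambda>x. x)"
      unfolding orthonormal_family_def tensor_basis_def
    proof clarify
      fix x y x' y' assume "x \<in> A" "y \<in> B" "x' \<in> A" "y' \<in> B"
      then have eq: "cinner (S x y) (S x' y') = (if x = x' \<and> y = y' then 1 else 0)"
        and self: "cinner (S x y) (S x y) = 1"
        by (simp_all add: cinner_tensor A.cinner_basis B.cinner_basis)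
      \<comment> \<open>The case split is on equality of tensors rather than of pairs:
        \<open>self\<close> settles equal tensors, and different tensors come from different
        pairs.\<close>
      show "cinner (S x y) (S x' y') = (if S x y = S x' y' then 1 else 0)"
      proof (cases "S x y = S x' y'")
        case True
        with self show ?thesis by simp
      next
        case False
        with eq show ?thesis by auto
      qed
    qed
    show "closure (cspan (tensor_basis A B)) = UNIV"
      unfolding tensor_basis_def by (rule hilbert_tensor_total[OF hilbert A.total B.total])
    show "(\<rho> \<circ> \<phi>) (s k) b \<in> tensor_basis A B"
      if k: "k \<in> {1..N * M}" and b: "b \<in> tensor_basis A B" for k b
    proof -
      obtain i j where ij: "i \<in> {1..N}" "j \<in> {1..M}" and k_eq: "k = M * (i - 1) + j"
        using gen_index_cases[OF k] .
      obtain x y where xy: "x \<in> A" "y \<in> B" and b_eq: "b = S x y"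
        using b by (auto simp: tensor_basis_def)
      show ?thesis
        unfolding k_eq b_eq gen_tensor[OF ij] tensor_basis_def
        using A.gen_closed[OF ij(1) xy(1)] B.gen_closed[OF ij(2) xy(2)] by blast
    qed
  qed
qed

text \<open>The branch indices of \<open>x\<close> and \<open>y\<close> combine to one index whose
  generator maps the tensor of the shifted vectors to \<open>S x y\<close>; the shift of the product
  inverts that generator.\<close>

lemma funpow_shift_tensor:
  assumes "cuntz_basis N t \<pi>\<^sub>1 A" and "cuntz_basis M r \<pi>\<^sub>2 B" and xy: "x \<in> A" "y \<in> B"
  shows "(prod.shift ^^ n) (S x y) = S ((left.shift ^^ n) x) ((right.shift ^^ n) y)"
proof -
  interpret A: cuntz_basis N t \<pi>\<^sub>1 A by fact
  interpret B: cuntz_basis M r \<pi>\<^sub>2 B by fact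
  have one: "prod.shift (S x y) = S (left.shift x) (right.shift y)"
    if xy: "x \<in> A" "y \<in> B" for x y
  proof -
    have "(\<rho> \<circ> \<phi>) (s (M * (A.branch x - 1) + B.branch y)) (S (left.shift x) (right.shift y)) = S x y"
      using gen_tensor[OF A.branch(1) B.branch(1), OF xy] A.branch(2)[OF xy(1)] B.branch(2)[OF xy(2)]
      by simp
    then show ?thesis
      using prod.shift_gen[OF gen_index[OF A.branch(1) B.branch(1), OF xy],
          of "S (left.shift x) (right.shift y)"]
      by (simp only:)
  qed
  show ?thesis
  proof (induction n)
    case (Suc n)
    have "(prod.shift ^^ Suc n) (S x y) = prod.shift (S ((left.shift ^^ n) x) ((right.shift ^^ n) y))"
      by (simp only: funpow.simps comp_apply Suc.IH)
    also have "\<dots> = S (left.shift ((left.shift ^^ n) x)) (right.shift ((right.shift ^^ n) y))"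
      by (intro one A.funpow_shift_basis B.funpow_shift_basis xy)
    also have "\<dots> = S ((left.shift ^^ Suc n) x) ((right.shift ^^ Suc n) y)"
      by simp
    finally show ?case .
  qed simp
qed

section \<open>Cycles, chains and permutative bases in the product\<close>

lemma tensor_cycles:
  assumes "is_cycle N t UNIV \<pi>\<^sub>1" and "is_cycle M r UNIV \<pi>\<^sub>2"
  shows "direct_sum_of (is_cycle (N * M) s) UNIV (\<rho> \<circ> \<phi>)"
proof -
  obtain A where A: "cuntz_basis N t \<pi>\<^sub>1 A"
    and perA: "\<And>x. x \<in> A \<Longrightarrow> \<exists>m k. k > 0 \<and> (left.shift ^^ (m + k)) x = (left.shift ^^ m) x"
    by (rule left.cycle_basis[OF assms(1)]) blast
  obtain B where B: "cuntz_basis M r \<pi>\<^sub>2 B"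
    and perB: "\<And>y. y \<in> B \<Longrightarrow> \<exists>m k. k > 0 \<and> (right.shift ^^ (m + k)) y = (right.shift ^^ m) y"
    by (rule right.cycle_basis[OF assms(2)]) blast
  interpret AB: cuntz_basis "N * M" s "\<rho> \<circ> \<phi>" "tensor_basis A B"
    by (rule cuntz_basis_tensor[OF A B])
  show ?thesis
  proof (rule AB.direct_sum_class_spaces)
    fix b assume b: "b \<in> tensor_basis A B"
    then obtain x y where xy: "x \<in> A" "y \<in> B" and b_eq: "b = S x y"
      by (auto simp: tensor_basis_def)
    obtain m k where mk: "k > 0" "(left.shift ^^ (m + k)) x = (left.shift ^^ m) x"
      using perA[OF xy(1)] by blast
    obtain n l where nl: "l > 0" "(right.shift ^^ (n + l)) y = (right.shift ^^ n) y"
      using perB[OF xy(2)] by blast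
    \<comment> \<open>Both factors get the common preperiod \<open>m + n\<close> and the common
      period \<open>k * l\<close>.\<close>
    have "(left.shift ^^ (m + n + k * l)) x = (left.shift ^^ (m + n)) x"
      using mk(2) by (rule funpow_eventually_periodic) simp
    moreover have "(right.shift ^^ (m + n + k * l)) y = (right.shift ^^ (m + n)) y"
      unfolding mult.commute[of k l] using nl(2) by (rule funpow_eventually_periodic) simp
    ultimately have "(prod.shift ^^ (m + n + k * l)) b = (prod.shift ^^ (m + n)) b"
      unfolding b_eq funpow_shift_tensor[OF A B xy] by (simp only:)
    then show "is_cycle (N * M) s (AB.class_space b) (\<rho> \<circ> \<phi>)"
      using mk(1) nl(1) by (intro AB.is_cycle_class_space[OF b, of "k * l"]) simp_all
  qed
qed

lemma tensor_permutative_chain: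
  assumes "permutative N t UNIV \<pi>\<^sub>1" and "is_chain M r UNIV \<pi>\<^sub>2"
  shows "direct_sum_of (is_chain (N * M) s) UNIV (\<rho> \<circ> \<phi>)"
proof -
  obtain A where A: "cuntz_basis N t \<pi>\<^sub>1 A"
    by (rule left.permutative_basis[OF assms(1)])
  obtain B where B: "cuntz_basis M r \<pi>\<^sub>2 B"
    and injB: "\<And>y. y \<in> B \<Longrightarrow> inj (\<lambda>n. (right.shift ^^ n) y)"
    by (rule right.chain_basis[OF assms(2)]) blast
  interpret A: cuntz_basis N t \<pi>\<^sub>1 A by (rule A)
  interpret B: cuntz_basis M r \<pi>\<^sub>2 B by (rule B)
  interpret AB: cuntz_basis "N * M" s "\<rho> \<circ> \<phi>" "tensor_basis A B"
    by (rule cuntz_basis_tensor[OF A B])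
  show ?thesis
  proof (rule AB.direct_sum_class_spaces, rule AB.is_chain_class_space)
    fix b assume "b \<in> tensor_basis A B"
    then obtain x y where xy: "x \<in> A" "y \<in> B" and b_eq: "b = S x y"
      by (auto simp: tensor_basis_def)
    show "inj (\<lambda>n. (prod.shift ^^ n) b)"
    proof (rule injI)
      fix m n
      let ?x = "\<lambda>n. (left.shift ^^ n) x" and ?y = "\<lambda>n. (right.shift ^^ n) y"
      note basis = A.funpow_shift_basis[OF xy(1)] B.funpow_shift_basis[OF xy(2)]
      assume "(prod.shift ^^ m) b = (prod.shift ^^ n) b"
      then have "S (?x m) (?y m) = S (?x n) (?y n)"
        unfolding b_eq funpow_shift_tensor[OF A B xy] .
      \<comment> \<open>Each factor is 0 or 1, so the product 1 forces equality in the second slot,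
        where the orbit is injective.\<close>
      then have "cinner (?x m) (?x n) * cinner (?y m) (?y n) = 1"
        using cinner_tensor[of "?x m" "?y m" "?x n" "?y n"] cinner_tensor[of "?x n" "?y n" "?x n" "?y n"]
        by (simp add: A.cinner_basis B.cinner_basis basis)
      then have "?y m = ?y n"
        by (auto simp: A.cinner_basis B.cinner_basis basis split: if_splits)
      then show "m = n"
        by (rule injD[OF injB[OF xy(2)]])
    qed
  qed
qed

lemma tensor_permutative:
  assumes "permutative N t UNIV \<pi>\<^sub>1" and "permutative M r UNIV \<pi>\<^sub>2"
  shows "permutative (N * M) s UNIV (\<rho> \<circ> \<phi>)"
proof -
  obtain A where A: "cuntz_basis N t \<pi>\<^sub>1 A"
    by (rule left.permutative_basis[OF assms(1)])
  obtain B where B: "cuntz_basis M r \<pi>\<^sub>2 B"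
    by (rule right.permutative_basis[OF assms(2)])
  show ?thesis
    by (rule cuntz_basis.permutative[OF cuntz_basis_tensor[OF A B]])
qed

end

theorem theorem1p5:
  fixes N M :: nat
    and t :: "nat \<Rightarrow> 'a::cstar_algebra"
    and r :: "nat \<Rightarrow> 'b::cstar_algebra"
    and s :: "nat \<Rightarrow> 'c::cstar_algebra"
    and T :: "'a \<Rightarrow> 'b \<Rightarrow> 'd::cstar_algebra"
    and \<phi> :: "'c \<Rightarrow> 'd"
    and S :: "'h::complex_hilbert_space \<Rightarrow> 'k::complex_hilbert_space \<Rightarrow> 'l::complex_hilbert_space"
    and \<pi>\<^sub>1 :: "'a \<Rightarrow> 'h \<Rightarrow> 'h"
    and \<pi>\<^sub>2 :: "'b \<Rightarrow> 'k \<Rightarrow> 'k"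
    and \<rho> :: "'d \<Rightarrow> 'l \<Rightarrow> 'l"
  assumes "N \<ge> 2" and "M \<ge> 2"
    and "cuntz_algebra N t" and "cuntz_algebra M r" and "cuntz_algebra (N * M) s"
    and "cstar_tensor T" and "cuntz_embedding N M t r s T \<phi>"
    and "hilbert_tensor S"
    and "star_rep UNIV \<pi>\<^sub>1" and "star_rep UNIV \<pi>\<^sub>2"
    and "tensor_rep T S \<pi>\<^sub>1 \<pi>\<^sub>2 \<rho>"
  shows "(permutative N t UNIV \<pi>\<^sub>1 \<and> permutative M r UNIV \<pi>\<^sub>2 \<longrightarrow>
            permutative (N * M) s UNIV (\<rho> \<circ> \<phi>)) \<and>
         (is_cycle N t UNIV \<pi>\<^sub>1 \<and> is_cycle M r UNIV \<pi>\<^sub>2 \<longrightarrow>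
            direct_sum_of (is_cycle (N * M) s) UNIV (\<rho> \<circ> \<phi>)) \<and>
         (permutative N t UNIV \<pi>\<^sub>1 \<and> is_chain M r UNIV \<pi>\<^sub>2 \<longrightarrow>
            direct_sum_of (is_chain (N * M) s) UNIV (\<rho> \<circ> \<phi>))"
proof -
  interpret cuntz_tensor N t \<pi>\<^sub>1 M r \<pi>\<^sub>2 s T \<phi> S \<rho>
    using assms by unfold_locales
  show ?thesis
    using tensor_permutative tensor_cycles tensor_permutative_chain by blast
qed

end
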